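(* $\bar n(t,d)<2d+(t-1)(d-2)+3$ for all integers $d\ge 4$ and $t\ge 2$.
   Context: An oriented matroid $M$ on a finite set $E$ is acyclic if it has no positive circuit. A reorientation of $M$ on $A\subseteq E$ is obtained by changing the signs of the elements of $A$ in all signed circuits of $M$; it is acyclic if the resulting oriented matroid is acyclic. An element $e$ of an acyclic oriented matroid is interior if there is a signed circuit $C=(C^+,C^-)$ with $C^-=\{e\}$. For integers $t\ge 0$, $d\ge 1$, $\bar n(t,d)$ is the largest integer $m$ such that every uniform oriented matroid of rank $d+1$ with $m$ elements has an acyclic reorientation with at most $t$ interior elements. *)

theory Defs
  imports Main
begin

(* A signed set (P, N) consists of its positive part P and its negative part N. *)
type_synonym 'a signed_set = "'a set \<times> 'a set"

definition pos_part :: "'a signed_set \<Rightarrow> 'a set" where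
  "pos_part X = fst X"

definition neg_part :: "'a signed_set \<Rightarrow> 'a set" where
  "neg_part X = snd X"

definition supp :: "'a signed_set \<Rightarrow> 'a set" where
  "supp X = pos_part X \<union> neg_part X"

definition opp :: "'a signed_set \<Rightarrow> 'a signed_set" where
  "opp X = (neg_part X, pos_part X)"

(* Oriented matroids on a finite ground set, given by the signed circuit axioms. *)
locale oriented_matroid =
  fixes E :: "'a set" and \<C> :: "'a signed_set set"
  assumes finite_ground: "finite E"
    and circuit_signed: "\<And>X. X \<in> \<C> \<Longrightarrow> pos_part X \<inter> neg_part X = {} \<and> supp X \<subseteq> E"
    and circuit_nonempty: "({}, {}) \<notin> \<C>"
    and circuit_opp: "\<And>X. X \<in> \<C> \<Longrightarrow> opp X \<in> \<C>"
    and circuit_incomparable: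
      "\<And>X Y. X \<in> \<C> \<Longrightarrow> Y \<in> \<C> \<Longrightarrow> supp X \<subseteq> supp Y \<Longrightarrow> X = Y \<or> X = opp Y"
    and circuit_elimination:
      "\<And>X Y e. X \<in> \<C> \<Longrightarrow> Y \<in> \<C> \<Longrightarrow> X \<noteq> opp Y \<Longrightarrow> e \<in> pos_part X \<inter> neg_part Y \<Longrightarrow>
        \<exists>Z\<in>\<C>. pos_part Z \<subseteq> (pos_part X \<union> pos_part Y) - {e}
             \<and> neg_part Z \<subseteq> (neg_part X \<union> neg_part Y) - {e}"

(* Independence, bases and rank refer to the underlying matroid, whose circuits
   are the supports of the signed circuits. *)
definition indep :: "'a set \<Rightarrow> 'a signed_set set \<Rightarrow> 'a set \<Rightarrow> bool" where
  "indep E \<C> I \<longleftrightarrow> I \<subseteq> E \<and> (\<forall>X\<in>\<C>. \<not> supp X \<subseteq> I)"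

definition basis :: "'a set \<Rightarrow> 'a signed_set set \<Rightarrow> 'a set \<Rightarrow> bool" where
  "basis E \<C> B \<longleftrightarrow> indep E \<C> B \<and> (\<forall>I. indep E \<C> I \<and> B \<subseteq> I \<longrightarrow> I = B)"

definition om_rank :: "'a set \<Rightarrow> 'a signed_set set \<Rightarrow> nat" where
  "om_rank E \<C> = Max (card ` {I. indep E \<C> I})"

definition uniform_om :: "'a set \<Rightarrow> 'a signed_set set \<Rightarrow> bool" where
  "uniform_om E \<C> \<longleftrightarrow> (\<forall>B. B \<subseteq> E \<and> card B = om_rank E \<C> \<longrightarrow> basis E \<C> B)"

definition acyclic_om :: "'a signed_set set \<Rightarrow> bool" where
  "acyclic_om \<C> \<longleftrightarrow> \<not> (\<exists>X\<in>\<C>. neg_part X = {})"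

definition flip_signs :: "'a set \<Rightarrow> 'a signed_set \<Rightarrow> 'a signed_set" where
  "flip_signs A X =
     ((pos_part X - A) \<union> (neg_part X \<inter> A), (neg_part X - A) \<union> (pos_part X \<inter> A))"

definition reorientation :: "'a set \<Rightarrow> 'a signed_set set \<Rightarrow> 'a signed_set set" where
  "reorientation A \<C> = flip_signs A ` \<C>"

definition interior_elements :: "'a set \<Rightarrow> 'a signed_set set \<Rightarrow> 'a set" where
  "interior_elements E \<C> = {e \<in> E. \<exists>X\<in>\<C>. neg_part X = {e}}"

(* Ground sets range over finite sets of natural numbers, which up to relabelling
   covers all finite ground sets. *)
definition reorientable_sizes :: "nat \<Rightarrow> nat \<Rightarrow> nat set" where
  "reorientable_sizes t d =
     {m. \<forall>(E :: nat set) \<C>.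
        oriented_matroid E \<C> \<and> uniform_om E \<C> \<and> om_rank E \<C> = d + 1 \<and> card E = m \<longrightarrow>
        (\<exists>A. A \<subseteq> E \<and> acyclic_om (reorientation A \<C>) \<and>
             card (interior_elements E (reorientation A \<C>)) \<le> t)}"

(* The Max is meaningful only if the set is finite (it always contains 0, vacuously). *)
definition nbar :: "nat \<Rightarrow> nat \<Rightarrow> nat" where
  "nbar t d = Max (reorientable_sizes t d)"

lemma om_rank_le_card:
  assumes "oriented_matroid E \<C>"
  shows "om_rank E \<C> \<le> card E"
proof -
  interpret oriented_matroid E \<C> by fact
  have "supp X \<noteq> {}" if "X \<in> \<C>" for X
    using that circuit_nonempty by (cases X) (auto simp: supp_def pos_part_def neg_part_def)
  then have ne: "indep E \<C> {}" by (auto simp: indep_def)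
  have sub: "{I. indep E \<C> I} \<subseteq> Pow E" by (auto simp: indep_def)
  then have "finite {I. indep E \<C> I}" using finite_ground by (simp add: finite_subset)
  then show ?thesis
    unfolding om_rank_def using ne sub finite_ground
    by (subst Max_le_iff) (auto intro!: card_mono)
qed

lemma zero_in_reorientable_sizes: "0 \<in> reorientable_sizes t d"
  using om_rank_le_card by (fastforce simp: reorientable_sizes_def)

end

theory Submission
  imports Defs Complex_Main "HOL-Library.Infinite_Set"
begin

text \<open>
  For every \<open>n\<close> that is at least \<open>2 d + (t - 1) (d - 2) + 3\<close> there is a uniform oriented matroid
  of rank \<open>r = d + 1\<close> on \<open>n\<close> elements all of whose acyclic reorientations have at least
  \<open>l = t + 1\<close> interior elements. So all reorientable sizes lie below the bound.

  The oriented matroid is the Lawrence oriented matroid of an \<open>r\<close> by \<open>n\<close> matrix \<open>a\<close> of signs,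
  realized by the vectors with entries \<open>a i e * M ^ (i * e)\<close> for a large number \<open>M\<close>. Because of
  the rapid growth, each equation of a linear dependency on \<open>r + 1\<close> columns is governed by two
  consecutive terms (\<open>consecutive_terms_cancel\<close>). So the circuit on columns \<open>j 0 < \<dots> < j r\<close> has
  equal signs at \<open>j i\<close> and \<open>j (i + 1)\<close> exactly if row \<open>i + 1\<close> of the matrix changes between
  these columns. Reorienting an element negates its column. A positive circuit is thus a chain
  of columns along which all rows change one after another, and greedy search for such chains
  from both ends gives two descending lattice paths, the top travel and the bottom travel. In an
  acyclic reorientation the top travel stays weakly above the bottom travel
  (\<open>top_row_le_bottom_row\<close>), and a column is interior if the travels pass it in equal or
  adjacent rows without dropping next to it (\<open>interior_element_near_travels\<close>).

  The matrix is built from a staircase: the first \<open>6 + (r - 3) l\<close> gaps between columns form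
  \<open>r - 1\<close> consecutive blocks of lengths \<open>3, l, \<dots>, l, 3\<close>, and at a gap of block \<open>h\<close> the rows up
  to \<open>h\<close> behave opposite to the rows below \<open>h\<close>, whatever the reorientation. So exactly one of
  the travels drops at a gap if the staircase separates them, and otherwise both or none do.

  Let the top travel be in row \<open>h - u\<close> and the bottom travel in row \<open>h + w\<close> at the start of
  block \<open>h\<close>, and consider \<open>w - u - 1\<close>, which compares the travels with the staircase. It is at
  least \<open>-1\<close> in the first column, with equality only if both travels are in row 1 there, and it
  is negative in the column at the end of the staircase, where the bottom travel starts, if this
  column is seen as the start of block \<open>r\<close>. In a block in which the travels remain separated it
  grows, because each of the at least three drops adds 1 and the descent of the staircase to the
  next block subtracts only 2. Travels that are at least two rows apart can rest without a drop
  after both have passed below the staircase, but then \<open>w - u - 1\<close> is still positive when the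
  staircase catches up with the top travel; for them to rest above the staircase, it must be
  negative already. Therefore \<open>w - u - 1\<close> can become negative only while the travels are close
  together: they meet at the staircase and rest side by side there for most of a block, which
  yields interior elements. The exact number is controlled by a potential that depends only on
  the positions of the travels relative to the staircase (\<open>main_reserve\<close>): it is at least \<open>l\<close> in
  the first column, it falls by at most one per gap, and it falls only at interior columns
  (\<open>many_near_columns\<close>).
\<close>

section \<open>Oriented matroids from linear dependencies\<close>

definition nonzeros :: "('a \<Rightarrow> real) \<Rightarrow> 'a set" where
  "nonzeros x = {e. x e \<noteq> 0}"

definition signs :: "('a \<Rightarrow> real) \<Rightarrow> 'a signed_set" where
  "signs x = ({e. 0 < x e}, {e. x e < 0})"

lemma pos_part_signs [simp]: "pos_part (signs x) = {e. 0 < x e}"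
  and neg_part_signs [simp]: "neg_part (signs x) = {e. x e < 0}"
  by (simp_all add: signs_def pos_part_def neg_part_def)

lemma supp_signs [simp]: "supp (signs x) = nonzeros x"
  by (auto simp: supp_def nonzeros_def)

lemma opp_signs: "opp (signs x) = signs (\<lambda>e. - x e)"
  by (simp add: opp_def) (simp add: signs_def)

text \<open>
  The linear dependencies of a vector configuration form a space of functions on the ground set.
  The last two assumptions say that any \<open>r\<close> of the vectors are independent while any \<open>r + 1\<close> of
  them are dependent, that is, the configuration has rank \<open>r\<close> and is in general position.
  Working with the dependencies alone avoids both vectors and determinants.
\<close>
locale uniform_dependencies =
  fixes E :: "'a set" and V :: "('a \<Rightarrow> real) set" and r :: nat
  assumes finite_E: "finite E"
    and nonzeros_subset: "x \<in> V \<Longrightarrow> nonzeros x \<subseteq> E"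
    and combination: "x \<in> V \<Longrightarrow> y \<in> V \<Longrightarrow> (\<lambda>e. a * x e + b * y e) \<in> V"
    and large_support: "x \<in> V \<Longrightarrow> nonzeros x \<noteq> {} \<Longrightarrow> r < card (nonzeros x)"
    and dependency: "J \<subseteq> E \<Longrightarrow> card J = Suc r \<Longrightarrow> \<exists>x\<in>V. nonzeros x \<noteq> {} \<and> nonzeros x \<subseteq> J"
begin

definition circuits :: "'a signed_set set" where
  "circuits = signs ` {x \<in> V. card (nonzeros x) = Suc r}"

lemma circuitE:
  assumes "X \<in> circuits"
  obtains x where "X = signs x" "x \<in> V" "card (nonzeros x) = Suc r"
  using assms unfolding circuits_def by blast

lemma scaled: "x \<in> V \<Longrightarrow> (\<lambda>e. a * x e) \<in> V"
  using combination[of x x a 0] by simp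

lemma finite_nonzeros: "x \<in> V \<Longrightarrow> finite (nonzeros x)"
  using nonzeros_subset finite_E finite_subset by blast

text \<open>
  A combination of \<open>x\<close> and \<open>y\<close> that vanishes at \<open>e\<close> has too small a support to be nonzero.
\<close>
lemma same_support_proportional:
  assumes "x \<in> V" "y \<in> V" "card (nonzeros x) = Suc r" "nonzeros y \<subseteq> nonzeros x" "e \<in> nonzeros x"
  shows "y f = y e / x e * x f"
proof -
  let ?z = "\<lambda>f. y e * x f + - x e * y f"
  have z: "?z \<in> V" using combination assms by blast
  have "nonzeros ?z \<subseteq> nonzeros x - {e}" using assms(4) by (auto simp: nonzeros_def)
  then have "card (nonzeros ?z) \<le> card (nonzeros x - {e})"
    by (rule card_mono[rotated]) (use finite_nonzeros assms in auto)
  also have "\<dots> = r" using assms finite_nonzeros by simp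
  finally have "nonzeros ?z = {}" using large_support[OF z] by linarith
  then have "y e * x f = x e * y f" by (auto simp: nonzeros_def)
  then show ?thesis using assms(5) by (simp add: nonzeros_def field_simps)
qed

lemma circuit_with_support:
  assumes "J \<subseteq> E" "card J = Suc r"
  obtains x where "x \<in> V" "nonzeros x = J"
proof -
  obtain x where x: "x \<in> V" "nonzeros x \<noteq> {}" "nonzeros x \<subseteq> J" using dependency assms by blast
  moreover have "finite J" using assms finite_E finite_subset by blast
  ultimately have "nonzeros x = J"
    using large_support[of x] assms(2) by (intro card_seteq) auto
  then show thesis using that x by blast
qed

text \<open>
  Signed elimination combines two dependencies linearly, and the result need not have minimal
  support. It can be shrunk without changing a sign: subtract the largest multiple of a minimal
  dependency that keeps all signs, which makes one more entry vanish.
\<close>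
lemma conformal_circuit:
  assumes "z \<in> V" "nonzeros z \<noteq> {}"
  shows "\<exists>x\<in>V. card (nonzeros x) = Suc r \<and> {e. 0 < x e} \<subseteq> {e. 0 < z e} \<and> {e. x e < 0} \<subseteq> {e. z e < 0}"
  using assms
proof (induction "card (nonzeros z)" arbitrary: z rule: less_induct)
  case less
  have fin: "finite (nonzeros z)" using finite_nonzeros less.prems by blast
  show ?case
  proof (cases "card (nonzeros z) = Suc r")
    case True
    then show ?thesis using less.prems by blast
  next
    case False
    then have big: "Suc r < card (nonzeros z)" using large_support[OF less.prems] by simp
    then obtain J where J: "J \<subseteq> nonzeros z" "card J = Suc r"
      by (meson less_imp_le obtain_subset_with_card_n)
    then obtain y where y: "y \<in> V" "nonzeros y = J"
      using circuit_with_support nonzeros_subset less.prems(1) by (metis order_trans)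
    from J obtain p where p: "p \<in> J" by fastforce
    \<comment> \<open>scaled so that \<open>x\<close> agrees in sign with \<open>z\<close> at \<open>p\<close>, hence \<open>S\<close> below is not empty\<close>
    define x where "x = (\<lambda>e. (y p * z p) * y e)"
    have xV: "x \<in> V" unfolding x_def by (rule scaled) (use y in blast)
    have "y p \<noteq> 0" "z p \<noteq> 0" using p y J by (auto simp: nonzeros_def)
    then have nzx: "nonzeros x = J" and pp: "0 < x p * z p"
      using y by (auto simp: x_def nonzeros_def zero_less_mult_iff mult_less_0_iff linorder_neq_iff)
    define S where "S = {e\<in>J. 0 < x e * z e}"
    have S: "finite S" "S \<noteq> {}" using fin J pp p by (auto simp: S_def intro: finite_subset)
    obtain q where q: "q \<in> S" "\<And>e. e \<in> S \<Longrightarrow> z q / x q \<le> z e / x e"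
      using arg_min_if_finite(1)[OF S, of "\<lambda>e. z e / x e"] arg_min_least[OF S, of _ "\<lambda>e. z e / x e"]
      by blast
    define c where "c = z q / x q"
    have c: "0 < c" "c * x q = z q" using q(1)
      by (auto simp: c_def S_def zero_less_mult_iff zero_less_divide_iff)
    define w where "w = (\<lambda>e. 1 * z e + (- c) * x e)"
    have wV: "w \<in> V" unfolding w_def by (rule combination) (use less.prems xV in auto)
    have conf: "(0 < w e \<longrightarrow> 0 < z e) \<and> (w e < 0 \<longrightarrow> z e < 0)" for e
    proof (cases "e \<in> S")
      case True
      then have "c \<le> z e / x e" using q(2) c_def by blast
      then show ?thesis using True
        by (auto simp: w_def S_def field_simps zero_less_mult_iff split: if_splits)
    next
      case False
      then have "x e * z e \<le> 0" using nzx by (auto simp: S_def nonzeros_def)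
      moreover have "z e = 0 \<Longrightarrow> x e = 0" using nzx J by (auto simp: nonzeros_def)
      ultimately have "(0 < z e \<and> x e \<le> 0) \<or> (z e < 0 \<and> 0 \<le> x e) \<or> (z e = 0 \<and> x e = 0)"
        by (smt (verit) mult_pos_pos mult_neg_neg)
      then show ?thesis
      proof (elim disjE conjE)
        assume "0 < z e" "x e \<le> 0"
        moreover from this have "c * x e \<le> 0" using c(1) by (simp add: mult_nonneg_nonpos)
        ultimately show ?thesis by (simp add: w_def)
      next
        assume "z e < 0" "0 \<le> x e"
        moreover from this have "0 \<le> c * x e" using c(1) by simp
        ultimately show ?thesis by (simp add: w_def)
      qed (simp add: w_def)
    qed
    have nzw: "nonzeros w \<subseteq> nonzeros z" using conf by (auto simp: nonzeros_def) (metis linorder_neq_iff)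
    have "q \<in> nonzeros z" "q \<notin> nonzeros w" using q(1) c(2) J by (auto simp: w_def nonzeros_def S_def)
    then have less': "card (nonzeros w) < card (nonzeros z)" using nzw fin
      by (intro psubset_card_mono) auto
    have "J \<noteq> nonzeros z" using big J by auto
    then obtain g where "g \<in> nonzeros z" "g \<notin> J" using J by blast
    then have "g \<in> nonzeros w" using nzx by (auto simp: w_def nonzeros_def)
    then have "nonzeros w \<noteq> {}" by blast
    from less.hyps[OF less' wV this] obtain v where v: "v \<in> V" "card (nonzeros v) = Suc r"
      "{e. 0 < v e} \<subseteq> {e. 0 < w e}" "{e. v e < 0} \<subseteq> {e. w e < 0}" by blast
    moreover have "{e. 0 < w e} \<subseteq> {e. 0 < z e}" "{e. w e < 0} \<subseteq> {e. z e < 0}"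
      using conf by auto
    ultimately show ?thesis by blast
  qed
qed

lemma oriented_matroid_circuits: "oriented_matroid E circuits"
proof
  show "finite E" by (rule finite_E)
  show "pos_part X \<inter> neg_part X = {} \<and> supp X \<subseteq> E" if X: "X \<in> circuits" for X
  proof -
    obtain x where "X = signs x" "nonzeros x \<subseteq> E" using X nonzeros_subset by (elim circuitE) blast
    then show ?thesis by auto
  qed
  show "({}, {}) \<notin> circuits"
  proof
    assume "({}, {}) \<in> circuits"
    then obtain x :: "'a \<Rightarrow> real" where x: "({}, {}) = signs x" "card (nonzeros x) = Suc r"
      by (elim circuitE)
    have "nonzeros x = {}" unfolding supp_signs[symmetric] x(1)[symmetric]
      by (simp add: supp_def pos_part_def neg_part_def)
    then show False using x(2) by simp
  qed
  show "opp X \<in> circuits" if X: "X \<in> circuits" for X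
  proof -
    obtain x where x: "X = signs x" "x \<in> V" "card (nonzeros x) = Suc r" using X by (elim circuitE)
    moreover have "nonzeros (\<lambda>e. - x e) = nonzeros x" by (simp add: nonzeros_def)
    ultimately show ?thesis using scaled[of x "-1"] unfolding circuits_def by (auto simp: opp_signs)
  qed
  show "X = Y \<or> X = opp Y" if XY: "X \<in> circuits" "Y \<in> circuits" "supp X \<subseteq> supp Y" for X Y
  proof -
    obtain x y where x: "X = signs x" "x \<in> V" "card (nonzeros x) = Suc r"
      and y: "Y = signs y" "y \<in> V" "card (nonzeros y) = Suc r" using XY(1,2) by (elim circuitE)
    have sub: "nonzeros x \<subseteq> nonzeros y" using XY x y by simp
    then have eq: "nonzeros x = nonzeros y" using x y finite_nonzeros by (metis card_subset_eq)
    obtain e where e: "e \<in> nonzeros y" using y by fastforce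
    define c where "c = x e / y e"
    have multiple: "x f = c * y f" for f
      unfolding c_def using same_support_proportional[OF y(2) x(2) y(3) sub e] .
    have "c \<noteq> 0" using e eq by (auto simp: c_def nonzeros_def)
    then consider "0 < c" | "c < 0" by linarith
    then show ?thesis
    proof cases
      case 1
      then have "X = Y" unfolding x y signs_def multiple
        by (simp add: zero_less_mult_iff mult_less_0_iff)
      then show ?thesis ..
    next
      case 2
      then have "X = opp Y" unfolding x y opp_signs unfolding signs_def multiple
        by (simp add: zero_less_mult_iff mult_less_0_iff)
      then show ?thesis ..
    qed
  qed
  show "\<exists>Z\<in>circuits. pos_part Z \<subseteq> (pos_part X \<union> pos_part Y) - {e}
             \<and> neg_part Z \<subseteq> (neg_part X \<union> neg_part Y) - {e}"
    if XY: "X \<in> circuits" "Y \<in> circuits" "X \<noteq> opp Y" "e \<in> pos_part X \<inter> neg_part Y" for X Y e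
  proof -
    obtain x y where x: "X = signs x" "x \<in> V" "card (nonzeros x) = Suc r"
      and y: "Y = signs y" "y \<in> V" "card (nonzeros y) = Suc r" using XY(1,2) by (elim circuitE)
    have e: "0 < x e" "y e < 0" using XY(4) x y by auto
    define z where "z = (\<lambda>f. (- y e) * x f + x e * y f)"
    have zV: "z \<in> V" unfolding z_def by (rule combination) (use x y in auto)
    have "nonzeros z \<noteq> {}"
    proof
      assume "nonzeros z = {}"
      then have eq: "x e * y f = y e * x f" for f
        by (simp add: z_def nonzeros_def)
      define c where "c = y e / x e"
      have "c < 0" using e by (simp add: c_def divide_neg_pos)
      have multiple: "y f = c * x f" for f
        using eq[of f] e by (simp add: c_def field_simps)
      have "X = opp Y" unfolding x y opp_signs unfolding signs_def multiple
        using \<open>c < 0\<close> by (simp add: zero_less_mult_iff mult_less_0_iff)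
      then show False using XY(3) by blast
    qed
    then obtain v where v: "v \<in> V" "card (nonzeros v) = Suc r"
      "{e. 0 < v e} \<subseteq> {e. 0 < z e}" "{e. v e < 0} \<subseteq> {e. z e < 0}"
      using conformal_circuit[OF zV] by blast
    have ze: "z e = 0" by (simp add: z_def)
    have zpos: "0 < x f \<or> 0 < y f" if "0 < z f" for f
    proof (rule ccontr)
      assume "\<not> ?thesis"
      then have "(- y e) * x f \<le> 0" "x e * y f \<le> 0" using e
        by (auto simp: mult_le_0_iff zero_le_mult_iff)
      then show False using that by (simp add: z_def)
    qed
    have zneg: "x f < 0 \<or> y f < 0" if "z f < 0" for f
    proof (rule ccontr)
      assume "\<not> ?thesis"
      then have "0 \<le> (- y e) * x f" "0 \<le> x e * y f" using e
        by (auto simp: mult_le_0_iff zero_le_mult_iff)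
      then show False using that by (simp add: z_def)
    qed
    have "pos_part (signs v) \<subseteq> (pos_part X \<union> pos_part Y) - {e}
        \<and> neg_part (signs v) \<subseteq> (neg_part X \<union> neg_part Y) - {e}"
      using v(3,4) ze zpos zneg unfolding x y by fastforce
    then show ?thesis using v(1,2) unfolding circuits_def by blast
  qed
qed

lemma indep_circuits: "indep E circuits I \<longleftrightarrow> I \<subseteq> E \<and> card I \<le> r"
proof
  assume I: "indep E circuits I"
  then have IE: "I \<subseteq> E" by (simp add: indep_def)
  moreover have "card I \<le> r"
  proof (rule ccontr)
    assume "\<not> card I \<le> r"
    then have "Suc r \<le> card I" by simp
    then obtain J where J: "J \<subseteq> I" "card J = Suc r" by (meson obtain_subset_with_card_n)
    then obtain x where "x \<in> V" "nonzeros x = J" using circuit_with_support IE by (metis order_trans)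
    then have "signs x \<in> circuits" "supp (signs x) \<subseteq> I" using J by (auto simp: circuits_def)
    then show False using I unfolding indep_def by blast
  qed
  ultimately show "I \<subseteq> E \<and> card I \<le> r" by blast
next
  assume I: "I \<subseteq> E \<and> card I \<le> r"
  then have "finite I" using finite_E finite_subset by blast
  then have "\<not> nonzeros x \<subseteq> I" if "card (nonzeros x) = Suc r" for x
    using I that card_mono[of I "nonzeros x"] by auto
  then show "indep E circuits I" using I by (auto simp: indep_def circuits_def)
qed

lemma om_rank_circuits:
  assumes "r \<le> card E" shows "om_rank E circuits = r"
  unfolding om_rank_def
proof (rule Max_eqI)
  show "finite (card ` {I. indep E circuits I})"
    using finite_E by (auto simp: indep_circuits intro!: finite_imageI finite_subset[of _ "Pow E"])
  show "y \<le> r" if "y \<in> card ` {I. indep E circuits I}" for y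
    using that by (auto simp: indep_circuits)
  obtain B where "B \<subseteq> E" "card B = r" using assms by (meson obtain_subset_with_card_n)
  then show "r \<in> card ` {I. indep E circuits I}"
    by (auto simp: indep_circuits image_iff intro!: exI[of _ B])
qed

lemma uniform_om_circuits:
  assumes "r \<le> card E" shows "uniform_om E circuits"
  unfolding uniform_om_def om_rank_circuits[OF assms] basis_def indep_circuits
proof (intro allI impI)
  fix B assume B: "B \<subseteq> E \<and> card B = r"
  have "I = B" if "(I \<subseteq> E \<and> card I \<le> r) \<and> B \<subseteq> I" for I
    using that B finite_E card_seteq[of I B] finite_subset by fastforce
  then show "(B \<subseteq> E \<and> card B \<le> r) \<and> (\<forall>I. (I \<subseteq> E \<and> card I \<le> r) \<and> B \<subseteq> I \<longrightarrow> I = B)"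
    using B by blast
qed

end

section \<open>Systems with rapidly growing coefficients\<close>

text \<open>
  Gaussian elimination: an unknown with a nonzero coefficient in one equation is eliminated from
  the others.
\<close>
lemma homogeneous_system:
  fixes A :: "'i \<Rightarrow> 'j \<Rightarrow> 'f::field"
  assumes "finite I" "finite J" "card I < card J"
  shows "\<exists>x. (\<exists>j\<in>J. x j \<noteq> 0) \<and> (\<forall>j. j \<notin> J \<longrightarrow> x j = 0) \<and> (\<forall>i\<in>I. (\<Sum>j\<in>J. A i j * x j) = 0)"
  using assms
proof (induction I arbitrary: J A rule: finite_induct)
  case empty
  then obtain p where "p \<in> J" by fastforce
  then show ?case by (intro exI[of _ "\<lambda>j. if j = p then 1 else 0"]) auto
next
  case (insert i I)
  show ?case
  proof (cases "\<forall>j\<in>J. A i j = 0")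
    case True
    have "card I < card J" using insert by simp
    from insert.IH[OF insert.prems(1) this, of A] obtain x where
      "\<exists>j\<in>J. x j \<noteq> 0" "\<forall>j. j \<notin> J \<longrightarrow> x j = 0" "\<forall>i\<in>I. (\<Sum>j\<in>J. A i j * x j) = 0" by blast
    moreover have "(\<Sum>j\<in>J. A i j * x j) = 0" using True by simp
    ultimately show ?thesis by blast
  next
    case False
    then obtain p where p: "p \<in> J" "A i p \<noteq> 0" by blast
    let ?K = "J - {p}" and ?A = "\<lambda>k j. A k j - A k p * A i j / A i p"
    have "finite ?K" "card I < card ?K" using insert p by simp_all
    from insert.IH[OF this, of ?A] obtain x where x: "\<exists>j\<in>?K. x j \<noteq> 0" "\<And>j. j \<notin> ?K \<Longrightarrow> x j = 0"
      "\<And>k. k \<in> I \<Longrightarrow> (\<Sum>j\<in>?K. ?A k j * x j) = 0" by blast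
    define s where "s = (\<Sum>j\<in>?K. A i j * x j)"
    define y where "y = x(p := - s / A i p)"
    have sum_y: "(\<Sum>j\<in>J. A k j * y j) = A k p * (- s / A i p) + (\<Sum>j\<in>?K. A k j * x j)" for k
    proof -
      have "(\<Sum>j\<in>?K. A k j * y j) = (\<Sum>j\<in>?K. A k j * x j)"
        by (rule sum.cong) (auto simp: y_def)
      then show ?thesis using p insert.prems by (simp add: sum.remove[of J p] y_def)
    qed
    have "(\<Sum>j\<in>J. A k j * y j) = 0" if "k \<in> I" for k
    proof -
      have "(\<Sum>j\<in>?K. ?A k j * x j) = (\<Sum>j\<in>?K. A k j * x j) - A k p / A i p * s"
        unfolding s_def sum_distrib_left sum_subtractf[symmetric]
        by (rule sum.cong) (auto simp: algebra_simps)
      then show ?thesis using x(3)[OF that] by (simp add: sum_y)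
    qed
    moreover have "(\<Sum>j\<in>J. A i j * y j) = 0" using p by (simp add: sum_y s_def[symmetric])
    moreover have "\<exists>j\<in>J. y j \<noteq> 0" using x(1) by (auto simp: y_def)
    moreover have "\<forall>j. j \<notin> J \<longrightarrow> y j = 0" using x(2) p by (auto simp: y_def)
    ultimately show ?thesis by (intro exI[of _ y]) auto
  qed
qed

lemma increasing_less:
  fixes j :: "nat \<Rightarrow> nat"
  assumes "\<And>k. k < r \<Longrightarrow> j k < j (Suc k)" "k < k'" "k' \<le> r"
  shows "j k < j k'"
  using assms(2,3) by (induction rule: less_Suc_induct) (use assms(1) in \<open>auto intro: less_trans\<close>)

lemma increasing_inj_on:
  fixes j :: "nat \<Rightarrow> nat"
  assumes "\<And>k. k < r \<Longrightarrow> j k < j (Suc k)"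
  shows "inj_on j {..r}"
proof (rule inj_onI)
  fix k k' assume "k \<in> {..r}" "k' \<in> {..r}" "j k = j k'"
  then show "k = k'"
    using increasing_less[of r j k k'] increasing_less[of r j k' k] assms
    by (cases k k' rule: linorder_cases) auto
qed

lemma finite_strict_enumeration:
  fixes J :: "nat set"
  assumes "card J = Suc r"
  obtains j where "\<And>k. k < r \<Longrightarrow> j k < j (Suc k)" "j ` {..r} = J"
proof -
  have fin: "finite J" using assms by (metis card.infinite nat.distinct(1))
  obtain j where j: "strict_mono_on {..<card J} j" "\<forall>k<card J. j k \<in> J"
    using finite_enumerate[OF fin] by blast
  have inj: "inj_on j {..r}" using j(1) assms strict_mono_on_imp_inj_on[OF j(1)]
    by (simp add: lessThan_Suc_atMost)
  have "j ` {..r} \<subseteq> J" using j(2) assms by auto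
  moreover have "card (j ` {..r}) = card J" using inj assms by (simp add: card_image)
  ultimately have "j ` {..r} = J" using fin by (simp add: card_subset_eq)
  moreover have "j k < j (Suc k)" if "k < r" for k
    using j(1) that assms by (auto intro: strict_mono_onD)
  ultimately show thesis using that by blast
qed

text \<open>
  In a vanishing sum the largest term must be compensated by terms of the other sign, one of
  which is at least \<open>1 / (r + 1)\<close> as large. Both are then comparable to all terms.
\<close>
lemma dominant_terms_cancel:
  fixes t :: "nat \<Rightarrow> real"
  assumes "(\<Sum>k\<le>r. t k) = 0" and "q \<le> r" "t q \<noteq> 0"
  obtains k k' where "k \<le> r" "k' \<le> r" "0 < t k" "t k' < 0"
    "\<And>i. i \<le> r \<Longrightarrow> \<bar>t i\<bar> \<le> (real r + 1) * \<bar>t k\<bar>" "\<And>i. i \<le> r \<Longrightarrow> \<bar>t i\<bar> \<le> (real r + 1) * \<bar>t k'\<bar>"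
proof -
  note conclude = that
  have half: thesis
    if s: "(\<Sum>k\<le>r. s k) = 0" and p: "p \<le> r" "0 < s p" "\<And>i. i \<le> r \<Longrightarrow> \<bar>s i\<bar> \<le> s p"
    and st: "s = t \<or> s = (\<lambda>k. - t k)" for s p
  proof -
    have "\<exists>k\<le>r. s p \<le> (real r + 1) * (- s k)"
    proof (rule ccontr)
      assume "\<not> ?thesis"
      then have less: "(real r + 1) * (- s k) < s p" if "k \<le> r" for k
        using that by (meson not_le)
      have small: "- (s p / (real r + 1)) < s k" if "k \<le> r" for k
        using less[OF that] by (simp add: field_simps)
      have "(\<Sum>k\<in>{..r} - {p}. - (s p / (real r + 1))) \<le> (\<Sum>k\<in>{..r} - {p}. s k)"
        by (rule sum_mono) (use small in \<open>auto intro: less_imp_le\<close>)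
      then have "- (r * (s p / (real r + 1))) \<le> (\<Sum>k\<in>{..r} - {p}. s k)" using p by simp
      moreover have "(\<Sum>k\<le>r. s k) = s p + (\<Sum>k\<in>{..r} - {p}. s k)"
        using p by (simp add: sum.remove)
      moreover have "r * (s p / (real r + 1)) < s p" using p by (simp add: field_simps)
      ultimately show False using s by linarith
    qed
    then obtain k where k: "k \<le> r" "s p \<le> (real r + 1) * (- s k)" by blast
    then have "s k < 0" using p(2) by (smt (verit) mult_nonneg_nonpos of_nat_0_le_iff)
    have big: "\<bar>s i\<bar> \<le> (real r + 1) * \<bar>s p\<bar>" "\<bar>s i\<bar> \<le> (real r + 1) * \<bar>s k\<bar>" if "i \<le> r" for i
    proof -
      have "\<bar>s i\<bar> \<le> s p" using p that by blast
      moreover have "0 \<le> r * s p" using p(2) by simp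
      moreover have "(real r + 1) * \<bar>s p\<bar> = s p + r * s p"
        using p(2) by (simp add: algebra_simps)
      moreover have "(real r + 1) * \<bar>s k\<bar> = (real r + 1) * (- s k)" using \<open>s k < 0\<close> by simp
      ultimately show "\<bar>s i\<bar> \<le> (real r + 1) * \<bar>s p\<bar>" "\<bar>s i\<bar> \<le> (real r + 1) * \<bar>s k\<bar>"
        using k(2) by linarith+
    qed
    from st show thesis
    proof
      assume "s = t"
      then show thesis using conclude[of p k] p k big \<open>s k < 0\<close> by auto
    next
      assume "s = (\<lambda>k. - t k)"
      then show thesis using conclude[of k p] p k big \<open>s k < 0\<close> by auto
    qed
  qed
  obtain p where p: "p \<le> r" "\<And>i. i \<le> r \<Longrightarrow> \<bar>t i\<bar> \<le> \<bar>t p\<bar>"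
  proof -
    have "finite ((\<lambda>k. \<bar>t k\<bar>) ` {..r})" "(\<lambda>k. \<bar>t k\<bar>) ` {..r} \<noteq> {}" by auto
    from Max_in[OF this] obtain p where p: "p \<le> r" "Max ((\<lambda>k. \<bar>t k\<bar>) ` {..r}) = \<bar>t p\<bar>" by blast
    have "\<bar>t k\<bar> \<le> \<bar>t p\<bar>" if "k \<le> r" for k
      unfolding p(2)[symmetric] using that by (intro Max_ge) auto
    then show thesis using p(1) that by blast
  qed
  then have "t p \<noteq> 0" using assms(2,3) by fastforce
  then consider "0 < t p" | "0 < - t p" by linarith
  then show thesis
  proof cases
    case 1
    then show thesis using half[of t p] p assms by auto
  next
    case 2
    then show thesis using half[of "\<lambda>k. - t k" p] p assms by (auto simp: sum_negf)
  qed
qed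

text \<open>
  Consider \<open>r\<close> equations in the \<open>r + 1\<close> unknowns \<open>y 0, \<dots>, y r\<close> whose coefficients have absolute
  value \<open>M ^ (i * j k)\<close> with \<open>M\<close> large. In equation \<open>i\<close> let \<open>S i\<close> be the set of indices whose
  term is comparable to the largest one; it contains terms of both signs. Passing from one
  equation to the next multiplies the later terms by much more than the earlier ones, so
  everything in \<open>S (i + 1)\<close> lies weakly after everything in \<open>S i\<close>. Since each of the \<open>r\<close> sets
  has at least two elements and there are only \<open>r + 1\<close> indices, the sets must be \<open>{0, 1}\<close>,
  \<open>{1, 2}\<close>, and so on up to \<open>{r - 1, r}\<close>: equation \<open>i\<close> is governed by two consecutive terms,
  which therefore have opposite signs.
\<close>
lemma consecutive_terms_cancel:
  fixes r :: nat and a :: "nat \<Rightarrow> nat \<Rightarrow> real" and j :: "nat \<Rightarrow> nat" and y :: "nat \<Rightarrow> real"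
  defines "M \<equiv> (real r + 2)\<^sup>2"
  assumes a: "\<And>i k. \<bar>a i k\<bar> = 1"
    and j: "\<And>k. k < r \<Longrightarrow> j k < j (Suc k)"
    and rows: "\<And>i. 1 \<le> i \<Longrightarrow> i \<le> r \<Longrightarrow> (\<Sum>k\<le>r. a i k * M ^ (i * j k) * y k) = 0"
    and nonzero: "q \<le> r" "y q \<noteq> 0"
    and i: "1 \<le> i" "i \<le> r"
  shows "(a i (i - 1) * y (i - 1)) * (a i i * y i) < 0"
  \<comment> \<open>\<open>M\<close> exceeds \<open>(r + 1)\<^sup>2\<close>, the loss from comparing with the largest term in two equations\<close>
proof -
  define t where "t i k = a i k * M ^ (i * j k) * y k" for i k
  have M: "0 < M" by (simp add: M_def)
  have abs_t: "\<bar>t i k\<bar> = M ^ (i * j k) * \<bar>y k\<bar>" for i k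
    using a M by (simp add: t_def abs_mult)
  have mono_j: "j k < j k'" if "k < k'" "k' \<le> r" for k k'
    by (rule increasing_less[of r j]) (use j that in auto)
  define S where "S i = {k. k \<le> r \<and> (\<forall>k'\<le>r. \<bar>t i k'\<bar> \<le> (real r + 1) * \<bar>t i k\<bar>)}" for i
  have two: "\<exists>k\<in>S i. \<exists>k'\<in>S i. 0 < t i k \<and> t i k' < 0" if "1 \<le> i" "i \<le> r" for i
  proof -
    have sum: "(\<Sum>k\<le>r. t i k) = 0" using rows[OF that] by (simp add: t_def)
    have "\<bar>t i q\<bar> \<noteq> 0" unfolding abs_t using nonzero M by simp
    then have "t i q \<noteq> 0" by simp
    from dominant_terms_cancel[OF sum nonzero(1) this] obtain k k' where kk:
      "k \<le> r" "k' \<le> r" "0 < t i k" "t i k' < 0"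
      "\<And>n. n \<le> r \<Longrightarrow> \<bar>t i n\<bar> \<le> (real r + 1) * \<bar>t i k\<bar>" "\<And>n. n \<le> r \<Longrightarrow> \<bar>t i n\<bar> \<le> (real r + 1) * \<bar>t i k'\<bar>"
      by metis
    have "k \<in> S i" "k' \<in> S i" unfolding S_def using kk(1,2,5,6) by blast+
    then show ?thesis using kk(3,4) by blast
  qed
  have climb: "k \<le> k'" if k: "k \<in> S i" "k' \<in> S (Suc i)" "1 \<le> i" "Suc i \<le> r" for i k k'
  proof (rule ccontr)
    assume "\<not> k \<le> k'"
    then have less: "k' < k" by simp
    have kr: "k \<le> r" "k' \<le> r" using k by (auto simp: S_def)
    obtain p where p: "t i p \<noteq> 0" "p \<le> r" using two[OF k(3)] k(4) by (force simp: S_def)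
    have "0 < (real r + 1) * \<bar>t i k\<bar>"
    proof -
      have "\<bar>t i p\<bar> \<le> (real r + 1) * \<bar>t i k\<bar>" using k(1) p(2) by (auto simp: S_def)
      then show ?thesis using p(1) by linarith
    qed
    then have pos: "0 < \<bar>t i k\<bar>" by (simp add: zero_less_mult_iff)
    have suc: "\<bar>t (Suc i) n\<bar> = M ^ j n * \<bar>t i n\<bar>" for n
      unfolding abs_t by (simp add: power_add)
    have M1: "1 \<le> M" using M_def by (simp add: power2_eq_square algebra_simps)
    have "M * M ^ j k' \<le> M ^ j k"
      using mono_j[OF less kr(1)] M1 power_increasing[of "Suc (j k')" "j k" M] by simp
    have "M * \<bar>t (Suc i) k'\<bar> = M * M ^ j k' * \<bar>t i k'\<bar>" by (simp add: suc)
    also have "\<dots> \<le> M ^ j k * ((real r + 1) * \<bar>t i k\<bar>)"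
      using k(1) kr \<open>M * M ^ j k' \<le> M ^ j k\<close> M by (intro mult_mono) (auto simp: S_def)
    also have "\<dots> = (real r + 1) * \<bar>t (Suc i) k\<bar>" by (simp add: suc)
    also have "\<dots> \<le> (real r + 1) * ((real r + 1) * \<bar>t (Suc i) k'\<bar>)"
      using k(2) kr by (intro mult_left_mono) (auto simp: S_def)
    finally have le: "M * \<bar>t (Suc i) k'\<bar> \<le> (real r + 1)\<^sup>2 * \<bar>t (Suc i) k'\<bar>"
      by (simp add: power2_eq_square mult.assoc)
    have "0 < \<bar>t (Suc i) k\<bar>" using pos M by (simp add: suc)
    moreover have "\<bar>t (Suc i) k\<bar> \<le> (real r + 1) * \<bar>t (Suc i) k'\<bar>" using k(2) kr by (auto simp: S_def)
    ultimately have "0 < (real r + 1) * \<bar>t (Suc i) k'\<bar>" by linarith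
    then have "0 < \<bar>t (Suc i) k'\<bar>" by (simp add: zero_less_mult_iff)
    then have "M \<le> (real r + 1)\<^sup>2" using le by simp
    then show False by (simp add: M_def power2_eq_square algebra_simps)
  qed
  have distinct: "\<exists>k\<in>S i. \<exists>k'\<in>S i. k < k'" if "1 \<le> i" "i \<le> r" for i
    using two[OF that] by (metis linorder_neqE_nat order_less_asym)
  have high: "\<exists>k\<in>S i. i \<le> k" if "1 \<le> i" "i \<le> r" for i
    using that
  proof (induction i rule: nat_induct_at_least)
    case base
    then obtain k k' where "k \<in> S 1" "k' \<in> S 1" "k < k'" using distinct[of 1] by auto
    then show ?case by (intro bexI[of _ k']) auto
  next
    case (Suc i)
    then obtain k where k: "k \<in> S i" "i \<le> k" by auto
    obtain n n' where "n \<in> S (Suc i)" "n' \<in> S (Suc i)" "n < n'" using distinct[of "Suc i"] Suc by auto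
    moreover have "k \<le> n" using climb[OF k(1)] calculation Suc by auto
    ultimately show ?case using k by (intro bexI[of _ n']) auto
  qed
  have low: "\<forall>k\<in>S i. k \<le> i" if "1 \<le> i" "i \<le> r" for i
    using that(2,1)
  proof (induction i rule: inc_induct)
    case base
    then show ?case by (simp add: S_def)
  next
    case (step i)
    show ?case
    proof
      fix k assume k: "k \<in> S i"
      obtain n n' where n: "n \<in> S (Suc i)" "n' \<in> S (Suc i)" "n < n'" using distinct[of "Suc i"] step
        by auto
      moreover have "k \<le> n" using climb[OF k n(1)] step by auto
      moreover have "n' \<le> Suc i" using step n by auto
      ultimately show "k \<le> i" by linarith
    qed
  qed
  have range: "k = i - 1 \<or> k = i" if k: "k \<in> S i" for k
  proof -
    have "i - 1 \<le> k"
    proof (cases "i = 1")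
      case False
      then have i': "1 \<le> i - 1" "i - 1 \<le> r" "Suc (i - 1) = i" using i by auto
      obtain k0 where "k0 \<in> S (i - 1)" "i - 1 \<le> k0" using high[OF i'(1,2)] by blast
      then show ?thesis using climb[of k0 "i - 1" k] k i i' by auto
    qed simp
    moreover have "k \<le> i" using low[OF i] k by blast
    ultimately show ?thesis by linarith
  qed
  obtain k k' where kk: "k \<in> S i" "k' \<in> S i" "0 < t i k" "t i k' < 0" using two[OF i] by blast
  then have "k \<noteq> k'" by auto
  then have "t i (i - 1) * t i i < 0"
    using kk range[OF kk(1)] range[OF kk(2)] by (auto simp: mult_less_0_iff)
  then have "(M ^ (i * j (i - 1)) * M ^ (i * j i)) * ((a i (i - 1) * y (i - 1)) * (a i i * y i)) < 0"
    by (simp add: t_def mult_ac)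
  then show ?thesis using M by (simp add: mult_less_0_iff zero_less_mult_iff)
qed

section \<open>Travels in a sign matrix\<close>

text \<open>
  The top travel starts in row 1 at the leftmost column, moves to the right, and drops to the
  next row whenever the entry of its current row changes. The bottom travel does the same from
  row \<open>r\<close> at column \<open>m\<close> towards the left and upwards. The values \<open>top_row x c\<close> and
  \<open>bottom_row x r m c\<close> are the rows in which the travels reach column \<open>c\<close>.
\<close>
primrec top_row :: "(nat \<Rightarrow> nat \<Rightarrow> 'b) \<Rightarrow> nat \<Rightarrow> nat" where
  "top_row x 0 = 1"
| "top_row x (Suc c) = (let i = top_row x c in if x i c = x i (Suc c) then i else Suc i)"

primrec bottom_row_rev :: "(nat \<Rightarrow> nat \<Rightarrow> 'b) \<Rightarrow> nat \<Rightarrow> nat \<Rightarrow> nat \<Rightarrow> nat" where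
  "bottom_row_rev x r m 0 = r"
| "bottom_row_rev x r m (Suc d) = (let i = bottom_row_rev x r m d in
     if x i (m - Suc d) = x i (m - d) then i else i - 1)"

definition bottom_row :: "(nat \<Rightarrow> nat \<Rightarrow> 'b) \<Rightarrow> nat \<Rightarrow> nat \<Rightarrow> nat \<Rightarrow> nat" where
  "bottom_row x r m c = bottom_row_rev x r m (m - c)"

lemma bottom_row_end [simp]: "bottom_row x r m m = r"
  by (simp add: bottom_row_def)

lemma bottom_row_step:
  assumes "c < m"
  shows "bottom_row x r m c = (let i = bottom_row x r m (Suc c) in if x i c = x i (Suc c) then i
      else i - 1)"
proof -
  have "m - c = Suc (m - Suc c)" "m - (m - Suc c) = Suc c" "m - Suc (m - Suc c) = c" using assms by auto
  then show ?thesis by (simp add: bottom_row_def)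
qed

lemma top_row_pos: "1 \<le> top_row x c"
  by (induction c) (auto simp: Let_def)

lemma bottom_row_le: "bottom_row x r m c \<le> r"
proof -
  have "bottom_row_rev x r m d \<le> r" for d
    by (induction d) (auto simp: Let_def)
  then show ?thesis by (simp add: bottom_row_def)
qed

text \<open>
  Columns \<open>j 0 < \<dots> < j r\<close> such that row \<open>i + 1\<close> changes between columns \<open>j i\<close> and \<open>j (i + 1)\<close>
  for all \<open>i < r\<close> will carry a positive circuit. Here \<open>left_chain x k c\<close> says that such a
  sequence can be started so that \<open>j k = c\<close>, and \<open>right_chain x r m d c\<close> that one with
  \<open>j (r - d) = c\<close> can be completed within the columns up to \<open>m\<close>.
\<close>
primrec left_chain :: "(nat \<Rightarrow> nat \<Rightarrow> 'b) \<Rightarrow> nat \<Rightarrow> nat \<Rightarrow> bool" where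
  "left_chain x 0 c \<longleftrightarrow> True"
| "left_chain x (Suc k) c \<longleftrightarrow> (\<exists>b<c. left_chain x k b \<and> x (Suc k) b \<noteq> x (Suc k) c)"

primrec right_chain :: "(nat \<Rightarrow> nat \<Rightarrow> 'b) \<Rightarrow> nat \<Rightarrow> nat \<Rightarrow> nat \<Rightarrow> nat \<Rightarrow> bool" where
  "right_chain x r m 0 c \<longleftrightarrow> c \<le> m"
| "right_chain x r m (Suc d) c \<longleftrightarrow> (\<exists>b>c. right_chain x r m d b \<and> x (r - d) c \<noteq> x (r - d) b)"

lemma top_row_crossing:
  assumes "k < top_row x c" "1 \<le> k"
  obtains g where "g < c" "top_row x g = k" "top_row x (Suc g) = Suc k" "x k g \<noteq> x k (Suc g)"
  using assms
proof (induction c arbitrary: thesis)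
  case 0
  then show ?case by simp
next
  case (Suc c)
  show ?case
  proof (cases "k < top_row x c")
    case True
    then obtain g where "g < c" "top_row x g = k" "top_row x (Suc g) = Suc k" "x k g \<noteq> x k (Suc g)"
      using Suc.IH Suc.prems(3) by blast
    then show ?thesis using Suc.prems(1)[of g] by simp
  next
    case False
    then have eq: "top_row x c = k"
      using Suc.prems(2) by (simp add: Let_def split: if_splits)
    moreover have "x k c \<noteq> x k (Suc c)"
      using False Suc.prems(2) eq by (auto simp: Let_def)
    ultimately show ?thesis using Suc.prems(1)[of c] by simp
  qed
qed

lemma bottom_row_crossing:
  assumes "bottom_row x r m c \<le> k" "k < r" "c \<le> m"
  obtains g where "c \<le> g" "g < m" "bottom_row x r m g = k" "bottom_row x r m (Suc g) = Suc k"
    "x (Suc k) g \<noteq> x (Suc k) (Suc g)"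
  using assms(3,1,2)
proof (induction c arbitrary: thesis rule: inc_induct)
  case base
  then show ?case by simp
next
  case (step c)
  show ?case
  proof (cases "bottom_row x r m (Suc c) \<le> k")
    case True
    then obtain g where "Suc c \<le> g" "g < m" "bottom_row x r m g = k" "bottom_row x r m (Suc g) = Suc k"
      "x (Suc k) g \<noteq> x (Suc k) (Suc g)"
      using step.IH step.prems(3) by blast
    then show ?thesis using step.prems(1)[of g] by simp
  next
    case False
    note row = bottom_row_step[OF step.hyps(2), of x r]
    have eq: "bottom_row x r m (Suc c) = Suc k"
      using False step.prems(2) row by (simp add: Let_def split: if_splits)
    then have "x (Suc k) c \<noteq> x (Suc k) (Suc c)" "bottom_row x r m c = k"
      using step.prems(2) row by (auto simp: Let_def split: if_splits)
    then show ?thesis using step.prems(1)[of c] step.hyps(2) eq by simp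
  qed
qed

text \<open>
  Where the travel leaves row \<open>k + 1\<close>, the two adjacent columns differ in that row, so one of
  them differs from column \<open>c\<close> and can precede it in the chain. The same idea gives the next
  three lemmas; for an unchanged entry, two values in a row leave no third possibility.
\<close>
lemma left_chain_above_top_row: "k < top_row x c \<Longrightarrow> left_chain x k c"
proof (induction k arbitrary: c)
  case (Suc k)
  obtain g where g: "g < c" "top_row x g = Suc k" "top_row x (Suc g) = Suc (Suc k)"
    "x (Suc k) g \<noteq> x (Suc k) (Suc g)" by (rule top_row_crossing[OF Suc.prems]) auto
  then have "left_chain x k g" "left_chain x k (Suc g)" using Suc.IH by simp_all
  moreover have "\<exists>b\<in>{g, Suc g}. b < c \<and> x (Suc k) b \<noteq> x (Suc k) c"
    using g by (cases "Suc g = c") auto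
  ultimately show ?case by auto
qed simp

lemma right_chain_below_bottom_row:
  "c \<le> m \<Longrightarrow> d \<le> r \<Longrightarrow> bottom_row x r m c \<le> r - d \<Longrightarrow> right_chain x r m d c"
proof (induction d arbitrary: c)
  case (Suc d)
  then obtain g where g: "c \<le> g" "g < m" "bottom_row x r m g = r - Suc d"
    "bottom_row x r m (Suc g) = Suc (r - Suc d)"
    "x (Suc (r - Suc d)) g \<noteq> x (Suc (r - Suc d)) (Suc g)"
    by (elim bottom_row_crossing) auto
  have s: "Suc (r - Suc d) = r - d" using Suc.prems(2) by simp
  have "right_chain x r m d g" "right_chain x r m d (Suc g)"
    using Suc.IH[of g] Suc.IH[of "Suc g"] Suc.prems g s by simp_all
  moreover have "\<exists>b\<in>{g, Suc g}. c < b \<and> x (r - d) c \<noteq> x (r - d) b"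
    using g s by (cases "g = c") auto
  ultimately show ?case by auto
qed simp

lemma left_chain_except_last:
  fixes x :: "nat \<Rightarrow> nat \<Rightarrow> bool"
  assumes "top_row x c = top_row x (Suc c)" "k < top_row x (Suc c)"
  shows "\<exists>b<Suc c. left_chain x k b \<and> x (Suc k) b = x (Suc k) (Suc c)"
proof (cases "Suc k < top_row x (Suc c)")
  case True
  then obtain g where g: "g < Suc c" "top_row x g = Suc k" "top_row x (Suc g) = Suc (Suc k)"
    "x (Suc k) g \<noteq> x (Suc k) (Suc g)" by (elim top_row_crossing) auto
  have left: "left_chain x k g" "left_chain x k (Suc g)"
    using g by (simp_all add: left_chain_above_top_row)
  have lt: "g < Suc c" "Suc g < Suc c"
    using assms g by (auto simp del: top_row.simps simp: less_Suc_eq)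
  have "x (Suc k) g = x (Suc k) (Suc c) \<or> x (Suc k) (Suc g) = x (Suc k) (Suc c)"
    using g(4) by blast
  then show ?thesis
  proof
    assume "x (Suc k) g = x (Suc k) (Suc c)"
    then show ?thesis using left lt by (intro exI[of _ g] conjI)
  next
    assume "x (Suc k) (Suc g) = x (Suc k) (Suc c)"
    then show ?thesis using left lt by (intro exI[of _ "Suc g"] conjI)
  qed
next
  case False
  then have eq: "top_row x c = Suc k" "top_row x (Suc c) = Suc k" using assms by linarith+
  have "x (Suc k) c = x (Suc k) (Suc c)"
  proof (rule ccontr)
    assume "x (Suc k) c \<noteq> x (Suc k) (Suc c)"
    then have "top_row x (Suc c) = Suc (Suc k)" using eq(1) by (simp add: Let_def)
    then show False using eq(2) by simp
  qed
  moreover have "left_chain x k c" using eq(1) by (simp add: left_chain_above_top_row)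
  ultimately show ?thesis by (intro exI[of _ c] conjI) simp_all
qed

lemma right_chain_except_first:
  fixes x :: "nat \<Rightarrow> nat \<Rightarrow> bool"
  assumes "c < m" "bottom_row x r m c = bottom_row x r m (Suc c)" "bottom_row x r m c \<le> r - d" "d < r"
  shows "\<exists>b>c. right_chain x r m d b \<and> x (r - d) c = x (r - d) b"
proof (cases "bottom_row x r m c = r - d")
  case True
  then have "x (r - d) c = x (r - d) (Suc c)"
    using assms bottom_row_step[OF assms(1), of x r] by (auto simp: Let_def split: if_splits)
  then show ?thesis using right_chain_below_bottom_row[of "Suc c" m d r x] True assms by auto
next
  case False
  then have "bottom_row x r m c \<le> r - Suc d" "r - Suc d < r" "c \<le> m" using assms by linarith+
  then obtain g where g: "c \<le> g" "g < m" "bottom_row x r m g = r - Suc d"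
    "bottom_row x r m (Suc g) = Suc (r - Suc d)"
    "x (Suc (r - Suc d)) g \<noteq> x (Suc (r - Suc d)) (Suc g)"
    by (rule bottom_row_crossing)
  have s: "Suc (r - Suc d) = r - d" using assms by simp
  have right: "right_chain x r m d g" "right_chain x r m d (Suc g)"
    using g s assms by (auto intro!: right_chain_below_bottom_row)
  have lt: "c < g" "c < Suc g" using assms g by (auto simp: le_less)
  have "x (r - d) c = x (r - d) g \<or> x (r - d) c = x (r - d) (Suc g)"
    using g(5) unfolding s by blast
  then show ?thesis
  proof
    assume "x (r - d) c = x (r - d) g"
    then show ?thesis using right lt by (intro exI[of _ g] conjI)
  next
    assume "x (r - d) c = x (r - d) (Suc g)"
    then show ?thesis using right lt by (intro exI[of _ "Suc g"] conjI)
  qed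
qed

lemma left_chain_columns:
  "left_chain x k c \<Longrightarrow> \<exists>j. j k = c \<and> (\<forall>i<k. j i < j (Suc i) \<and> x (Suc i) (j i) \<noteq> x (Suc i) (j (Suc i)))"
proof (induction k arbitrary: c)
  case (Suc k)
  then obtain b j where "b < c" "x (Suc k) b \<noteq> x (Suc k) c" "j k = b"
    "\<forall>i<k. j i < j (Suc i) \<and> x (Suc i) (j i) \<noteq> x (Suc i) (j (Suc i))" by fastforce
  then show ?case by (intro exI[of _ "j(Suc k := c)"]) (auto simp: less_Suc_eq)
qed auto

lemma right_chain_columns:
  "right_chain x r m d c \<Longrightarrow> d \<le> r \<Longrightarrow> \<exists>j. j (r - d) = c \<and> j r \<le> m \<and>
    (\<forall>i. r - d \<le> i \<and> i < r \<longrightarrow> j i < j (Suc i) \<and> x (Suc i) (j i) \<noteq> x (Suc i) (j (Suc i)))"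
proof (induction d arbitrary: c)
  case (Suc d)
  then obtain b where b: "c < b" "right_chain x r m d b" "x (r - d) c \<noteq> x (r - d) b" by auto
  then obtain j where j: "j (r - d) = b" "j r \<le> m"
    "\<forall>i. r - d \<le> i \<and> i < r \<longrightarrow> j i < j (Suc i) \<and> x (Suc i) (j i) \<noteq> x (Suc i) (j (Suc i))"
    using Suc.IH[of b] Suc.prems by auto
  define n where "n = r - Suc d"
  have n: "r - d = Suc n" "n < r" using Suc.prems by (auto simp: n_def)
  have "(j(n := c)) i < (j(n := c)) (Suc i) \<and>
      x (Suc i) ((j(n := c)) i) \<noteq> x (Suc i) ((j(n := c)) (Suc i))" if "n \<le> i" "i < r" for i
    using j b that n by (cases "i = n") auto
  moreover have "(j(n := c)) n = c" "(j(n := c)) r \<le> m" using j n by auto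
  ultimately show ?case unfolding n_def[symmetric] by blast
qed auto

section \<open>Lawrence oriented matroids\<close>

text \<open>
  The dependencies of the vectors with entries \<open>a i e * M ^ (i * e)\<close> for \<open>i = 1, \<dots>, r\<close>, where
  \<open>M\<close> is large and \<open>a\<close> has entries \<open>1\<close> and \<open>-1\<close>. They realize the Lawrence oriented matroid of
  the sign matrix \<open>a\<close>.
\<close>
definition lawrence_dependencies :: "nat \<Rightarrow> nat \<Rightarrow> (nat \<Rightarrow> nat \<Rightarrow> real) \<Rightarrow> (nat \<Rightarrow> real) set" where
  "lawrence_dependencies n r a = {x. (\<forall>e. n \<le> e \<longrightarrow> x e = 0) \<and>
     (\<forall>i\<in>{1..r}. (\<Sum>e<n. a i e * ((real r + 2)\<^sup>2) ^ (i * e) * x e) = 0)}"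

lemma nonzeros_lawrence_dependencies: "x \<in> lawrence_dependencies n r a \<Longrightarrow> nonzeros x \<subseteq> {..<n}"
  unfolding lawrence_dependencies_def nonzeros_def by (auto simp: not_le[symmetric])

lemma dependency_signs:
  assumes a: "\<And>i e. \<bar>a i e\<bar> = 1"
    and x: "x \<in> lawrence_dependencies n r a" "nonzeros x \<noteq> {}" "nonzeros x \<subseteq> j ` {..r}"
    and j: "\<And>k. k < r \<Longrightarrow> j k < j (Suc k)"
    and i: "i < r"
  shows "(a (Suc i) (j i) * x (j i)) * (a (Suc i) (j (Suc i)) * x (j (Suc i))) < 0"
proof -
  let ?M = "(real r + 2)\<^sup>2"
  have inj: "inj_on j {..r}" using j by (rule increasing_inj_on)
  have rows: "(\<Sum>k\<le>r. a l (j k) * ?M ^ (l * j k) * x (j k)) = 0" if "1 \<le> l" "l \<le> r" for l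
  proof -
    have "(\<Sum>k\<le>r. a l (j k) * ?M ^ (l * j k) * x (j k)) = (\<Sum>e\<in>j ` {..r}. a l e * ?M ^ (l * e) * x e)"
      by (simp add: sum.reindex[OF inj])
    also have "\<dots> = (\<Sum>e\<in>nonzeros x. a l e * ?M ^ (l * e) * x e)"
      by (rule sum.mono_neutral_right) (use x(3) in \<open>auto simp: nonzeros_def\<close>)
    also have "\<dots> = (\<Sum>e<n. a l e * ?M ^ (l * e) * x e)"
      by (rule sum.mono_neutral_left) (use nonzeros_lawrence_dependencies[OF x(1)] in \<open>auto simp: nonzeros_def\<close>)
    finally show ?thesis using x(1) that by (simp add: lawrence_dependencies_def)
  qed
  obtain q where q: "q \<le> r" "x (j q) \<noteq> 0" using x(2,3) by (auto simp: nonzeros_def)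
  show ?thesis
    using consecutive_terms_cancel[where a = "\<lambda>i k. a i (j k)"
        and y = "\<lambda>k. x (j k)" and r = r and j = j and i = "Suc i" and q = q]
      a j rows q i by simp
qed

lemma uniform_dependencies_lawrence:
  assumes a: "\<And>i e. \<bar>a i e\<bar> = 1" and r: "1 \<le> r"
  shows "uniform_dependencies {..<n} (lawrence_dependencies n r a) r"
proof
  let ?V = "lawrence_dependencies n r a" and ?M = "(real r + 2)\<^sup>2"
  show "finite {..<n}" by simp
  show "nonzeros x \<subseteq> {..<n}" if "x \<in> ?V" for x using that by (rule nonzeros_lawrence_dependencies)
  show "(\<lambda>e. b * x e + c * y e) \<in> ?V" if "x \<in> ?V" "y \<in> ?V" for x y b c
  proof -
    have "(\<Sum>e<n. a i e * ?M ^ (i * e) * (b * x e + c * y e)) =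
      b * (\<Sum>e<n. a i e * ?M ^ (i * e) * x e) + c * (\<Sum>e<n. a i e * ?M ^ (i * e) * y e)" for i
      unfolding sum_distrib_left sum.distrib[symmetric] by (rule sum.cong) (auto simp: algebra_simps)
    then show ?thesis using that by (simp add: lawrence_dependencies_def)
  qed
  show "r < card (nonzeros x)" if x: "x \<in> ?V" "nonzeros x \<noteq> {}" for x
  proof (rule ccontr)
    assume "\<not> r < card (nonzeros x)"
    \<comment> \<open>padding with indices that are no columns gives exactly \<open>r + 1\<close> indices\<close>
    define J where "J = nonzeros x \<union> {n..<n + (Suc r - card (nonzeros x))}"
    have fin: "finite (nonzeros x)" using nonzeros_lawrence_dependencies[OF x(1)] finite_subset by blast
    have "nonzeros x \<inter> {n..<n + (Suc r - card (nonzeros x))} = {}"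
      using nonzeros_lawrence_dependencies[OF x(1)] by auto
    then have "card J = Suc r"
      unfolding J_def using fin \<open>\<not> r < card (nonzeros x)\<close> by (simp add: card_Un_disjoint)
    then obtain j where j: "\<And>k. k < r \<Longrightarrow> j k < j (Suc k)" "j ` {..r} = J"
      using finite_strict_enumeration by blast
    have sub: "nonzeros x \<subseteq> j ` {..r}" by (simp add: j(2) J_def)
    have "x (j i) \<noteq> 0 \<and> x (j (Suc i)) \<noteq> 0" if "i < r" for i
      using dependency_signs[OF a x sub j(1) that] by force
    then have "x (j k) \<noteq> 0" if "k \<le> r" for k
      using that r by (cases k) auto
    then have "j ` {..r} \<subseteq> nonzeros x" by (auto simp: nonzeros_def)
    then have "card J \<le> card (nonzeros x)" using fin j(2) by (simp add: card_mono)
    then show False using \<open>card J = Suc r\<close> \<open>\<not> r < card (nonzeros x)\<close> by simp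
  qed
  show "\<exists>x\<in>?V. nonzeros x \<noteq> {} \<and> nonzeros x \<subseteq> J" if J: "J \<subseteq> {..<n}" "card J = Suc r" for J
  proof -
    have "finite J" using J finite_subset by blast
    then obtain x where x: "\<exists>e\<in>J. x e \<noteq> 0" "\<forall>e. e \<notin> J \<longrightarrow> x e = 0"
      "\<forall>i\<in>{1..r}. (\<Sum>e\<in>J. a i e * ?M ^ (i * e) * x e) = 0"
      using homogeneous_system[of "{1..r}" J "\<lambda>i e. a i e * ?M ^ (i * e)"] J(2) by auto
    have "(\<Sum>e<n. a i e * ?M ^ (i * e) * x e) = (\<Sum>e\<in>J. a i e * ?M ^ (i * e) * x e)" for i
      by (rule sum.mono_neutral_right) (use J x in auto)
    moreover have "x e = 0" if "n \<le> e" for e using that J x(2) by fastforce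
    ultimately have "x \<in> ?V" using x(3) by (simp add: lawrence_dependencies_def)
    moreover have "nonzeros x \<noteq> {}" "nonzeros x \<subseteq> J" using x by (auto simp: nonzeros_def)
    ultimately show ?thesis by blast
  qed
qed

locale lawrence_matroid =
  fixes n r :: nat and a :: "nat \<Rightarrow> nat \<Rightarrow> real"
  assumes unit_entries: "\<And>i e. \<bar>a i e\<bar> = 1" and rank_pos: "1 \<le> r"
begin

sublocale uniform_dependencies "{..<n}" "lawrence_dependencies n r a" r
  using unit_entries rank_pos by (rule uniform_dependencies_lawrence)

definition entry :: "nat set \<Rightarrow> nat \<Rightarrow> nat \<Rightarrow> bool" where
  "entry A i e \<longleftrightarrow> (a i e < 0) \<noteq> (e \<in> A)"

text \<open>
  The signs of the circuit on columns \<open>j 0 < \<dots> < j r\<close> can be read off the matrix row by row: two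
  consecutive elements have equal signs exactly if the corresponding row changes between them.
  Any pattern \<open>s\<close> of signs that is consistent with this rule is realized, up to a global sign
  that the opposite circuit corrects.
\<close>
lemma circuit_along_chain:
  fixes s :: "nat \<Rightarrow> bool"
  assumes j: "\<And>i. i < r \<Longrightarrow> j i < j (Suc i)" "j r < n"
    and s: "\<And>i. i < r \<Longrightarrow> (entry A (Suc i) (j i) \<noteq> entry A (Suc i) (j (Suc i))) \<longleftrightarrow> (s i = s (Suc i))"
  shows "\<exists>Y\<in>reorientation A circuits. neg_part Y = j ` {k. k \<le> r \<and> \<not> s k}"
proof -
  have inj: "inj_on j {..r}" using j(1) by (rule increasing_inj_on)
  have "j k < n" if "k \<le> r" for k
    using increasing_less[of r j k r] j that by (cases "k = r") auto
  then have J: "j ` {..r} \<subseteq> {..<n}" "card (j ` {..r}) = Suc r" using inj by (auto simp: card_image)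
  then obtain v where v: "v \<in> lawrence_dependencies n r a" "nonzeros v = j ` {..r}"
    by (rule circuit_with_support)
  define p where "p e \<longleftrightarrow> (0 < v e) \<noteq> (e \<in> A)" for e
  have nonzero: "v (j k) \<noteq> 0" if "k \<le> r" for k using v(2) that by (auto simp: nonzeros_def)
  have "p (j i) = p (j (Suc i)) \<longleftrightarrow> s i = s (Suc i)" if "i < r" for i
  proof -
    have "(a (Suc i) (j i) * v (j i)) * (a (Suc i) (j (Suc i)) * v (j (Suc i))) < 0"
      using v j(1) that by (intro dependency_signs[OF unit_entries v(1)]) auto
    then have "((a (Suc i) (j i) < 0) \<noteq> (0 < v (j i))) \<noteq>
      ((a (Suc i) (j (Suc i)) < 0) \<noteq> (0 < v (j (Suc i))))"
      using nonzero[of i] nonzero[of "Suc i"] that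
      by (auto simp: mult_less_0_iff zero_less_mult_iff)
    then show ?thesis using s[OF that] unfolding entry_def p_def by blast
  qed
  then have agree: "p (j k) = s k \<longleftrightarrow> p (j 0) = s 0" if "k \<le> r" for k
    using that by (induction k) (auto simp: Suc_le_eq)
  define u where "u = (if p (j 0) = s 0 then v else (\<lambda>e. - v e))"
  have u: "signs u \<in> circuits"
  proof -
    have "signs v \<in> circuits" unfolding circuits_def using v J(2) by auto
    moreover have "nonzeros (\<lambda>e. - v e) = nonzeros v" by (simp add: nonzeros_def)
    then have "signs (\<lambda>e. - v e) \<in> circuits"
      unfolding circuits_def using v J(2) scaled[of v "-1"] by auto
    ultimately show ?thesis by (simp add: u_def)
  qed
  have "neg_part (flip_signs A (signs u)) = {e. u e \<noteq> 0 \<and> ((0 < u e) = (e \<in> A))}"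
    unfolding flip_signs_def by (auto simp: neg_part_def[of "(_, _)"])
  also have "\<dots> = j ` {k. k \<le> r \<and> \<not> s k}"
  proof -
    have supp_u: "u e \<noteq> 0 \<longleftrightarrow> e \<in> j ` {..r}" for e
      unfolding v(2)[symmetric] by (simp add: u_def nonzeros_def)
    have "(0 < u (j k)) = (j k \<in> A) \<longleftrightarrow> \<not> s k" if "k \<le> r" for k
      using agree[OF that] nonzero[OF that] unfolding u_def p_def by auto
    then show ?thesis using supp_u by auto
  qed
  finally show ?thesis using u unfolding reorientation_def by blast
qed

lemma glue_columns:
  fixes f g :: "nat \<Rightarrow> nat"
  assumes "f k = c" "g k = c" "k \<le> r"
    and "\<And>i. i < k \<Longrightarrow> R i (f i) (f (Suc i))"
    and "\<And>i. k \<le> i \<Longrightarrow> i < r \<Longrightarrow> R i (g i) (g (Suc i))"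
  obtains j where "j k = c" "j r = g r" "\<And>i. i < r \<Longrightarrow> R i (j i) (j (Suc i))"
proof
  let ?j = "\<lambda>i. if i < k then f i else g i"
  show "?j k = c" "?j r = g r" using assms(2,3) by auto
  show "R i (?j i) (?j (Suc i))" if "i < r" for i
  proof (cases "i < k")
    case True
    then show ?thesis using assms(1,2) assms(4)[of i] by (cases "Suc i = k") auto
  next
    case False
    then show ?thesis using assms(5)[of i] that by simp
  qed
qed

text \<open>
  If the bottom travel passed strictly above the top travel, a left chain and a right chain
  could be joined at column \<open>c\<close> to one along which every row changes, which is a positive
  circuit.
\<close>
lemma top_row_le_bottom_row:
  assumes acyclic: "acyclic_om (reorientation A circuits)" and c: "c \<le> m" "m < n"
  shows "top_row (entry A) c \<le> bottom_row (entry A) r m c"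
proof (rule ccontr)
  let ?x = "entry A"
  assume "\<not> ?thesis"
  then have less: "bottom_row ?x r m c < top_row ?x c" by simp
  define k where "k = bottom_row ?x r m c"
  have kr: "k \<le> r" unfolding k_def by (rule bottom_row_le)
  have "left_chain ?x k c" using less by (simp add: k_def left_chain_above_top_row)
  then obtain j1 where j1: "j1 k = c"
    "\<forall>i<k. j1 i < j1 (Suc i) \<and> ?x (Suc i) (j1 i) \<noteq> ?x (Suc i) (j1 (Suc i))"
    using left_chain_columns by blast
  have "right_chain ?x r m (r - k) c" using kr c
    by (intro right_chain_below_bottom_row) (auto simp: k_def)
  then obtain j2 where j2: "j2 (r - (r - k)) = c" "j2 r \<le> m"
    "\<forall>i. r - (r - k) \<le> i \<and> i < r \<longrightarrow> j2 i < j2 (Suc i) \<and> ?x (Suc i) (j2 i) \<noteq> ?x (Suc i) (j2 (Suc i))"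
    using right_chain_columns[of ?x r m "r - k" c] by auto
  obtain j where j: "j r = j2 r"
    "\<And>i. i < r \<Longrightarrow> j i < j (Suc i) \<and> ?x (Suc i) (j i) \<noteq> ?x (Suc i) (j (Suc i))"
    by (rule glue_columns[where k = k and c = c and f = j1 and g = j2 and
        R = "\<lambda>i p q. p < q \<and> ?x (Suc i) p \<noteq> ?x (Suc i) q"])
      (use j1 j2 kr in auto)
  have "\<exists>Y\<in>reorientation A circuits. neg_part Y = j ` {k. k \<le> r \<and> \<not> True}"
    by (rule circuit_along_chain) (use j j2(2) c in auto)
  then show False using acyclic by (auto simp: acyclic_om_def)
qed

text \<open>
  A chain along which every row changes except for the two rows (or the one row) next to its
  member \<open>c\<close> carries a circuit in which \<open>c\<close> alone is negative.
\<close>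
lemma interior_element:
  assumes c: "c \<le> m" "m < n"
    and k: "k \<le> r"
    and left: "k = 0 \<or> (\<exists>b<c. left_chain (entry A) (k - 1) b \<and> entry A k b = entry A k c)"
    and right: "k = r \<or> (\<exists>b>c. right_chain (entry A) r m (r - Suc k) b \<and>
          entry A (Suc k) c = entry A (Suc k) b)"
  shows "c \<in> interior_elements {..<n} (reorientation A circuits)"
proof -
  let ?x = "entry A"
  let ?R = "\<lambda>i p q. p < q \<and> (?x (Suc i) p \<noteq> ?x (Suc i) q \<longleftrightarrow> i \<noteq> k \<and> Suc i \<noteq> k)"
  obtain j1 where j1: "j1 k = c" "\<And>i. i < k \<Longrightarrow> ?R i (j1 i) (j1 (Suc i))"
  proof (cases k)
    case 0
    then show thesis using that[of "\<lambda>_. c"] by simp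
  next
    case (Suc l)
    then obtain b where b: "b < c" "left_chain ?x l b" "?x k b = ?x k c" using left by auto
    then obtain j where j: "j l = b"
      "\<forall>i<l. j i < j (Suc i) \<and> ?x (Suc i) (j i) \<noteq> ?x (Suc i) (j (Suc i))"
      using left_chain_columns by blast
    have "?R i ((j(k := c)) i) ((j(k := c)) (Suc i))" if "i < k" for i
      using that j b Suc by (cases "i = l") auto
    then show thesis using that[of "j(k := c)"] by auto
  qed
  obtain j2 where j2: "j2 k = c" "j2 r \<le> m" "\<And>i. k \<le> i \<Longrightarrow> i < r \<Longrightarrow> ?R i (j2 i) (j2 (Suc i))"
  proof (cases "k = r")
    case True
    then show thesis using that[of "\<lambda>_. c"] c by simp
  next
    case False
    then obtain b where b: "c < b" "right_chain ?x r m (r - Suc k) b" "?x (Suc k) c = ?x (Suc k) b"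
      using right by auto
    have eq: "r - (r - Suc k) = Suc k" using False k by simp
    obtain j where j: "j (Suc k) = b" "j r \<le> m"
      "\<forall>i. Suc k \<le> i \<and> i < r \<longrightarrow> j i < j (Suc i) \<and> ?x (Suc i) (j i) \<noteq> ?x (Suc i) (j (Suc i))"
      using right_chain_columns[OF b(2)] unfolding eq by auto
    have "?R i ((j(k := c)) i) ((j(k := c)) (Suc i))" if "k \<le> i" "i < r" for i
      using that j b by (cases "i = k") auto
    then show thesis using that[of "j(k := c)"] j(2) False by auto
  qed
  obtain j where j: "j k = c" "j r = j2 r" "\<And>i. i < r \<Longrightarrow> ?R i (j i) (j (Suc i))"
    by (rule glue_columns[where k = k and c = c and f = j1 and g = j2 and R = ?R])
      (use j1 j2 k in auto)
  have "\<exists>Y\<in>reorientation A circuits. neg_part Y = j ` {i. i \<le> r \<and> \<not> (i \<noteq> k)}"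
    by (rule circuit_along_chain) (use j j2(2) c in auto)
  moreover have "j ` {i. i \<le> r \<and> \<not> (i \<noteq> k)} = {c}" using j(1) k by auto
  ultimately show ?thesis using c by (auto simp: interior_elements_def)
qed

text \<open>
  Column \<open>c\<close> is an interior element if the travels meet it in the same or in adjacent rows, the
  top travel has not just dropped and the bottom travel does not drop at the next step. At
  column 0 the top travel offers no predecessor of \<open>c\<close>, so there the bottom travel must already
  have reached row 1; column \<open>m\<close> is symmetric.
\<close>
lemma interior_element_near_travels:
  assumes acyclic: "acyclic_om (reorientation A circuits)" and c: "c \<le> m" "0 < m" "m < n"
    and near: "bottom_row (entry A) r m c \<le> Suc (top_row (entry A) c)"
    and fresh: "case c of 0 \<Rightarrow> bottom_row (entry A) r m 0 = 1 | Suc c' \<Rightarrow> top_row (entry A) c' = top_row (entry A) c"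
    and stays: "if c = m then top_row (entry A) c = r
        else bottom_row (entry A) r m c = bottom_row (entry A) r m (Suc c)"
  shows "c \<in> interior_elements {..<n} (reorientation A circuits)"
proof -
  let ?\<rho> = "top_row (entry A)" and ?\<beta> = "bottom_row (entry A) r m"
  have le: "?\<rho> c \<le> ?\<beta> c" "?\<beta> c \<le> r"
    using top_row_le_bottom_row[OF acyclic c(1,3)] by (auto simp: bottom_row_le)
  have right: "k = r \<or> (\<exists>b>c. right_chain (entry A) r m (r - Suc k) b \<and>
        entry A (Suc k) c = entry A (Suc k) b)"
    if "?\<beta> c \<le> Suc k" "k \<le> r" "c = m \<Longrightarrow> k = r" for k
  proof (cases "k = r")
    case False
    then have "c \<noteq> m" using that(3) by blast
    then have "r - (r - Suc k) = Suc k" "r - Suc k < r" "c < m" using False that(2) c by auto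
    then show ?thesis
      using right_chain_except_first[of c m "entry A" r "r - Suc k"] stays that by auto
  qed simp
  show ?thesis
  proof (cases c)
    case 0
    then have one: "?\<beta> 0 = 1" "?\<rho> 0 = 1" using fresh by auto
    then show ?thesis
      using right[of 0] 0 c(2) by (intro interior_element[OF c(1,3), of 0]) auto
  next
    case (Suc c')
    have pos: "1 \<le> ?\<rho> c" by (rule top_row_pos)
    show ?thesis
    proof (rule interior_element[OF c(1,3), of "?\<rho> c"])
      show "?\<rho> c = 0 \<or> (\<exists>b<c. left_chain (entry A) (?\<rho> c - 1) b \<and> entry A (?\<rho> c) b = entry A (?\<rho> c) c)"
        using left_chain_except_last[of "entry A" c' "?\<rho> c - 1"] Suc fresh pos by auto
      show "?\<rho> c = r \<or> (\<exists>b>c. right_chain (entry A) r m (r - Suc (?\<rho> c)) b \<and>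
            entry A (Suc (?\<rho> c)) c = entry A (Suc (?\<rho> c)) b)"
        by (rule right) (use near le stays in auto)
    qed (use le Suc in auto)
  qed
qed
end

section \<open>Reserves of interior elements\<close>

text \<open>
  A reserve is a lower bound for the number of interior columns from the current column on, seen
  from block \<open>h\<close> with \<open>k\<close> gaps of the block ahead. The state of the two travels is given by
  \<open>u = h - top row\<close>, \<open>w = bottom row - h\<close>, and the flag \<open>f\<close> for a top travel that has just
  dropped. The staircase separates the travels at a gap if \<open>0 \<le> u\<close> before and \<open>1 \<le> w\<close> after it;
  then exactly one of them drops, which raises \<open>w - u\<close> by 1. Otherwise both drop or neither
  does. Passing to the next block replaces \<open>(u, w)\<close> by \<open>(u + 1, w - 1)\<close>.

  For \<open>2 \<le> w\<close> the number \<open>k + w - u - 3\<close> predicts the value of \<open>w - u - 1\<close> at the next block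
  start if the travels stay separated. As long as it is not negative the full amount \<open>l\<close> is
  guaranteed, and each missing unit costs one element. The clauses with \<open>w = 1\<close> describe travels
  that are about to meet at the staircase; those with \<open>w \<le> 0\<close> describe travels that have met
  there, where a gap without drops makes a column interior. The parameter \<open>e\<close> is \<open>l - 3\<close> in the
  first block, which is that much shorter than the next one, and 0 otherwise. Nothing is
  promised in the other states: for instance, once both travels are far above the staircase and
  far apart, they can rest there until the end.

  Towards the right end there is less room, and the last two blocks have reserves of their own.
\<close>
definition main_reserve :: "int \<Rightarrow> int \<Rightarrow> int \<Rightarrow> int \<Rightarrow> int \<Rightarrow> bool \<Rightarrow> int" where
  "main_reserve l e k u w f = max 0
    (if w \<ge> 2 then l + min 0 (k + w - u - 3)
     else if w = 1 \<and> u = -1 then min l (l - 1 + k - of_bool f)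
     else if w = 1 \<and> u = 0 then min l (l - 2 + k - of_bool f)
     else if w = 1 \<and> 1 \<le> u \<and> u \<le> k then min l (l - 3 + k - u)
     else if w = 0 \<and> u = 0 then e + k - of_bool f
     else if u = 1 \<and> (w = 0 \<or> w = -1) then k - 2 - of_bool f
     else 0)"

definition penultimate_reserve :: "int \<Rightarrow> int \<Rightarrow> int \<Rightarrow> bool \<Rightarrow> int" where
  "penultimate_reserve k u w f = max 0
    (if w = 2 then (if u < 0 then k + 2 - u - of_bool f else k + 1 - u)
     else if w = 1 then (if u < 0 then k + 2 - of_bool f else k - u)
     else if w = 0 \<and> u = 0 then k - 1 - of_bool f
     else if w = 0 \<and> u = 1 then k - 2 - of_bool f
     else 0)"

definition last_reserve :: "int \<Rightarrow> int \<Rightarrow> int \<Rightarrow> bool \<Rightarrow> int" where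
  "last_reserve k u w f = max 0
    (if w = 1 then (if u \<le> 0 then k - u - of_bool f else k - u - 1)
     else if w = 0 \<and> u = 0 then k - 1 - of_bool f
     else 0)"

lemma main_reserve_nonneg: "0 \<le> main_reserve l e k u w f"
  by (simp add: main_reserve_def)

text \<open>
  The reserve decreases by at most one at every gap, and only if the current column is interior.
  Here \<open>p\<close> and \<open>q\<close> say whether the top and the bottom travel drop at the gap.
\<close>
lemma main_reserve_step:
  assumes "3 \<le> l" "1 \<le> k" "e = 0 \<and> k \<le> l \<or> e = l - 3 \<and> k \<le> 3"
    and "0 \<le> u + w" "0 \<le> (u - of_bool p) + (w + of_bool q)"
    and "p \<noteq> q \<longleftrightarrow> 0 \<le> u \<and> 1 \<le> w + of_bool q"
  shows "main_reserve l e k u w f \<le>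
    of_bool (\<not> f \<and> \<not> q \<and> u + w \<le> 1) + main_reserve l e (k - 1) (u - of_bool p) (w + of_bool q) p"
proof -
  consider (far) "2 \<le> w" | (below) "w = 1" "u = -1" | (here) "w = 1" "u = 0"
    | (above) "w = 1" "1 \<le> u" "u \<le> k" | (corner) "w = 0" "u = 0"
    | (late) "u = 1" "w = 0 \<or> w = -1" | (none) "\<not> 2 \<le> w" "\<not> (w = 1 \<and> u = -1)" "\<not> (w = 1 \<and> u = 0)"
        "\<not> (w = 1 \<and> 1 \<le> u \<and> u \<le> k)" "\<not> (w = 0 \<and> u = 0)" "\<not> (u = 1 \<and> (w = 0 \<or> w = -1))"
    by blast
  then show ?thesis
  proof cases
    case far
    then show ?thesis
      using assms by (cases f; cases p; cases q) (auto simp add: main_reserve_def min_def max_def)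
  next
    case below
    then show ?thesis
      using assms by (cases f; cases p; cases q) (simp_all add: main_reserve_def min_def)
  next
    case here
    then show ?thesis
      using assms by (cases f; cases p; cases q) (simp_all add: main_reserve_def min_def)
  next
    case above
    then show ?thesis
      using assms by (cases f; cases p; cases q) (simp_all add: main_reserve_def min_def)
  next
    case corner
    then show ?thesis
      using assms by (cases f; cases p; cases q) (auto simp add: main_reserve_def min_def max_def)
  next
    case late
    then show ?thesis
      using assms by (cases f; cases p; cases q) (auto simp add: main_reserve_def min_def max_def)
  next
    case none
    then have "main_reserve l e k u w f = 0"
      unfolding main_reserve_def by (simp only: simp_thms if_False max.idem)
    then show ?thesis by (simp add: main_reserve_nonneg)
  qed
qed

lemma penultimate_reserve_nonneg: "0 \<le> penultimate_reserve k u w f"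
  by (simp add: penultimate_reserve_def)

lemma last_reserve_nonneg: "0 \<le> last_reserve k u w f"
  by (simp add: last_reserve_def)

lemma penultimate_reserve_step:
  assumes "1 \<le> k"
    and "0 \<le> u + w" "0 \<le> (u - of_bool p) + (w + of_bool q)" "w + of_bool q \<le> 2"
    and "p \<noteq> q \<longleftrightarrow> 0 \<le> u \<and> 1 \<le> w + of_bool q"
  shows "penultimate_reserve k u w f \<le>
    of_bool (\<not> f \<and> \<not> q \<and> u + w \<le> 1) + penultimate_reserve (k - 1) (u - of_bool p) (w + of_bool q) p"
proof -
  consider "w = 2" | "w = 1" | "w = 0" "u = 0" | "w = 0" "u = 1"
    | (none) "w \<noteq> 2" "w \<noteq> 1" "\<not> (w = 0 \<and> u = 0)" "\<not> (w = 0 \<and> u = 1)"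
    by blast
  then show ?thesis
  proof cases
    case none
    then have "penultimate_reserve k u w f = 0"
      unfolding penultimate_reserve_def by (simp only: simp_thms if_False max.idem)
    then show ?thesis by (simp add: penultimate_reserve_nonneg)
  qed (use assms in \<open>cases f; cases p; cases q; auto simp add: penultimate_reserve_def max_def\<close>)+
qed

lemma last_reserve_step:
  assumes "1 \<le> k"
    and "0 \<le> u + w" "0 \<le> (u - of_bool p) + (w + of_bool q)" "w + of_bool q \<le> 1"
    and "p \<noteq> q \<longleftrightarrow> 0 \<le> u \<and> 1 \<le> w + of_bool q"
  shows "last_reserve k u w f \<le>
    of_bool (\<not> f \<and> \<not> q \<and> u + w \<le> 1) + last_reserve (k - 1) (u - of_bool p) (w + of_bool q) p"
proof -
  consider "w = 1" | "w = 0" "u = 0" | (none) "w \<noteq> 1" "\<not> (w = 0 \<and> u = 0)"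
    by blast
  then show ?thesis
  proof cases
    case none
    then have "last_reserve k u w f = 0"
      unfolding last_reserve_def by (simp only: simp_thms if_False max.idem)
    then show ?thesis by (simp add: last_reserve_nonneg)
  qed (use assms in \<open>cases f; cases p; cases q; auto simp add: last_reserve_def max_def\<close>)+
qed

lemma main_reserve_next:
  assumes "3 \<le> l" "e = 0 \<or> e = l - 3" "0 \<le> u + w"
  shows "main_reserve l e 0 u w f \<le> main_reserve l 0 l (u + 1) (w - 1) f"
proof -
  consider "3 \<le> w" | "w = 2" | "w = 1" "u = -1" | "w = 1" "u = 0" | "w = 0" "u = 0"
    | (none) "w \<le> 1" "w = 1 \<longrightarrow> 1 \<le> u" "w = 0 \<longrightarrow> u \<noteq> 0"
    using assms(3) by linarith
  then show ?thesis
  proof cases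
    case none
    then have "main_reserve l e 0 u w f = 0"
      by (auto simp: main_reserve_def max_def)
    then show ?thesis by (simp add: main_reserve_nonneg)
  qed (use assms in \<open>cases f; auto simp add: main_reserve_def min_def max_def\<close>)+
qed

lemma main_reserve_penultimate:
  assumes "3 \<le> l" "0 \<le> u + w" "w \<le> 3"
  shows "main_reserve l 0 0 u w f \<le> penultimate_reserve l (u + 1) (w - 1) f"
proof -
  consider "w = 3" | "w = 2" | "w = 1" "u = -1" | "w = 1" "u = 0" | "w = 0" "u = 0"
    | (none) "w \<le> 1" "w = 1 \<longrightarrow> 1 \<le> u" "w = 0 \<longrightarrow> u \<noteq> 0"
    using assms(2,3) by linarith
  then show ?thesis
  proof cases
    case none
    then have "main_reserve l 0 0 u w f = 0"
      by (auto simp: main_reserve_def max_def)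
    then show ?thesis by (simp add: penultimate_reserve_nonneg)
  qed (use assms in \<open>cases f; auto simp add: main_reserve_def penultimate_reserve_def min_def max_def\<close>)+
qed

lemma penultimate_reserve_last:
  assumes "0 \<le> u + w" "w \<le> 2"
  shows "penultimate_reserve 0 u w f \<le> last_reserve 3 (u + 1) (w - 1) f"
  using assms
  by (cases f) (auto simp: last_reserve_def penultimate_reserve_def max_def)

lemma last_reserve_end:
  assumes "0 \<le> u + 1"
  shows "last_reserve 0 u 1 f \<le> of_bool (\<not> f \<and> u = -1)"
  using assms by (cases f) (auto simp: last_reserve_def max_def)

lemma main_reserve_start:
  assumes "3 \<le> l" "0 \<le> w"
  shows "l \<le> main_reserve l (l - 3) 3 0 w (w \<noteq> 0)"
proof -
  consider "w = 0" | "w = 1" | "2 \<le> w" using assms by linarith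
  then show ?thesis
    by cases (use assms in \<open>auto simp: main_reserve_def min_def\<close>)
qed

section \<open>Two travels along a staircase\<close>

text \<open>
  The gaps between the first \<open>7 + (r - 3) l\<close> columns are divided into \<open>r - 1\<close> blocks of lengths
  \<open>3, l, \<dots>, l, 3\<close>. Block \<open>h\<close> starts at column \<open>block_start r l h\<close>, and \<open>block_start r l r\<close> is
  the last of these columns.
\<close>
definition block_start :: "nat \<Rightarrow> nat \<Rightarrow> nat \<Rightarrow> nat" where
  "block_start r l h = (if h \<le> 1 then 0 else if h < r then 3 + (h - 2) * l else 6 + (r - 3) * l)"

lemma block_start_Suc:
  assumes "5 \<le> r" "1 \<le> h" "h < r"
  shows "block_start r l (Suc h) = block_start r l h + (if h = 1 \<or> Suc h = r then 3 else l)"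
proof -
  consider "h = 1" | "2 \<le> h" "Suc h < r" | "Suc h = r" using assms by linarith
  then show ?thesis
  proof cases
    case 2
    then obtain k where "h = k + 2" by (metis add.commute le_Suc_ex)
    then show ?thesis using 2 by (simp add: block_start_def)
  next
    case 3
    then obtain k where "h = k + 4" using assms
      by (metis Suc_le_mono add.commute eval_nat_numeral(2) eval_nat_numeral(3) le_Suc_ex)
    then show ?thesis using 3 by (auto simp: block_start_def algebra_simps)
  qed (use assms in \<open>auto simp: block_start_def\<close>)
qed

lemma block_start_mono:
  assumes "5 \<le> r" "h \<le> h'" "h' \<le> r"
  shows "block_start r l h \<le> block_start r l h'"
  using assms(2,3)
proof (induction h' rule: dec_induct)
  case (step i)
  then show ?case
    using block_start_Suc[OF assms(1), of i l] by (cases "i = 0") (auto simp: block_start_def)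
qed simp

text \<open>
  The combinatorial content of the travels in the sign matrix constructed below: two descending
  lattice paths \<open>\<rho> \<le> \<beta>\<close>, of which exactly one drops at a gap if and only if the staircase
  separates them there.
\<close>
locale corridor =
  fixes r l m :: nat and \<rho> \<beta> :: "nat \<Rightarrow> nat"
  assumes r5: "5 \<le> r" and l3: "3 \<le> l"
    and m: "m = block_start r l r"
    and \<rho>_start: "\<rho> 0 = 1" and \<beta>_end: "\<beta> m = r"
    and \<rho>_step: "\<rho> (Suc c) = \<rho> c \<or> \<rho> (Suc c) = Suc (\<rho> c)"
    and \<beta>_step: "c < m \<Longrightarrow> \<beta> (Suc c) = \<beta> c \<or> \<beta> (Suc c) = Suc (\<beta> c)"
    and \<beta>_le: "\<beta> c \<le> r"
    and ordered: "c \<le> m \<Longrightarrow> \<rho> c \<le> \<beta> c"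
    and opposite: "c < m \<Longrightarrow> (\<rho> (Suc c) \<noteq> \<rho> c) \<noteq> (\<beta> (Suc c) \<noteq> \<beta> c) \<longleftrightarrow>
      block_start r l (\<rho> c) \<le> c \<and> c < block_start r l (\<beta> (Suc c))"
begin

definition dropped :: "nat \<Rightarrow> bool" where
  "dropped c \<longleftrightarrow> (case c of 0 \<Rightarrow> \<beta> 0 \<noteq> 1 | Suc c' \<Rightarrow> \<rho> c' \<noteq> \<rho> c)"

definition near :: "nat \<Rightarrow> bool" where
  "near c \<longleftrightarrow> \<not> dropped c \<and> \<beta> c \<le> Suc (\<rho> c) \<and> (if c = m then \<rho> c = r else \<beta> c = \<beta> (Suc c))"

definition near_from :: "nat \<Rightarrow> nat set" where
  "near_from c = {c'. c \<le> c' \<and> c' \<le> m \<and> near c'}"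

definition reserve :: "nat \<Rightarrow> nat \<Rightarrow> nat \<Rightarrow> int" where
  "reserve h k c =
    (let u = int h - int (\<rho> c); w = int (\<beta> c) - int h in
     if h + 3 \<le> r then main_reserve (int l) (if h = 1 then int l - 3 else 0) (int k) u w (dropped c)
     else if h + 2 = r then penultimate_reserve (int k) u w (dropped c)
     else last_reserve (int k) u w (dropped c))"

lemma finite_near_from: "finite (near_from c)"
  by (rule finite_subset[of _ "{..m}"]) (auto simp: near_from_def)

lemma card_near_from_step:
  assumes "c \<le> m"
  shows "int (card (near_from c)) = of_bool (near c) + int (card (near_from (Suc c)))"
proof -
  have "near_from c = (if near c then insert c (near_from (Suc c)) else near_from (Suc c))"
    using assms by (auto simp: near_from_def Suc_le_eq le_less)
  moreover have "c \<notin> near_from (Suc c)" by (simp add: near_from_def)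
  ultimately show ?thesis using finite_near_from[of "Suc c"] by simp
qed

lemma \<rho>_pos: "1 \<le> \<rho> c"
proof (induction c)
  case (Suc c)
  then show ?case using \<rho>_step[of c] by auto
qed (simp add: \<rho>_start)

lemma reserve_step:
  assumes h: "1 \<le> h" "h < r" and c: "block_start r l h \<le> c" "Suc c + k = block_start r l (Suc h)"
  shows "reserve h (Suc k) c \<le> of_bool (near c) + reserve h k (Suc c)"
proof -
  define u w where "u = int h - int (\<rho> c)" and "w = int (\<beta> c) - int h"
  define p q where "p \<longleftrightarrow> \<rho> (Suc c) \<noteq> \<rho> c" and "q \<longleftrightarrow> \<beta> (Suc c) \<noteq> \<beta> c"
  have cm: "c < m" using c block_start_mono[of r "Suc h" r l] h r5 by (simp add: m)
  have u': "int h - int (\<rho> (Suc c)) = u - of_bool p"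
    using \<rho>_step[of c] by (auto simp: u_def p_def)
  have w': "int (\<beta> (Suc c)) - int h = w + of_bool q"
    using \<beta>_step[OF cm] by (auto simp: w_def q_def)
  have dropped: "dropped (Suc c) = p" by (auto simp: dropped_def p_def)
  have near: "near c \<longleftrightarrow> \<not> dropped c \<and> \<not> q \<and> u + w \<le> 1"
    using cm by (auto simp: near_def u_def w_def q_def)
  have le: "\<rho> c \<le> r" "\<beta> (Suc c) \<le> r" "1 \<le> \<beta> (Suc c)"
    using \<beta>_le[of c] \<beta>_le[of "Suc c"] ordered[of c] ordered[of "Suc c"] \<rho>_pos[of "Suc c"] cm
    by linarith+
  have row: "block_start r l i \<le> c \<longleftrightarrow> i \<le> h" if "i \<le> r" for i
    using block_start_mono[OF r5, of i h l] block_start_mono[OF r5, of "Suc h" i l] c h that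
    by (cases "i \<le> h") auto
  have opp: "p \<noteq> q \<longleftrightarrow> 0 \<le> u \<and> 1 \<le> w + of_bool q"
    using opposite[OF cm] row[OF le(1)] row[OF le(2)]
    unfolding p_def[symmetric] q_def[symmetric] w'[symmetric]
    by (auto simp: u_def not_le[symmetric])
  have uw: "0 \<le> u + w" "0 \<le> (u - of_bool p) + (w + of_bool q)"
    using ordered[of c] ordered[of "Suc c"] cm unfolding u'[symmetric] w'[symmetric]
    by (auto simp: u_def w_def)
  have top: "w + of_bool q \<le> int r - int h" unfolding w'[symmetric] using le by simp
  have k: "Suc k \<le> (if h = 1 \<or> Suc h = r then 3 else l)"
    using c block_start_Suc[OF r5 h, of l] by linarith
  note simps = reserve_def Let_def u_def[symmetric] w_def[symmetric] u' w' dropped near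
  consider "h + 3 \<le> r" | "h + 2 = r" | "h + 1 = r" using h by linarith
  then show ?thesis
  proof cases
    case 1
    have "main_reserve (int l) (if h = 1 then int l - 3 else 0) (int (Suc k)) u w (dropped c) \<le>
      of_bool (\<not> dropped c \<and> \<not> q \<and> u + w \<le> 1) +
      main_reserve (int l) (if h = 1 then int l - 3
          else 0) (int (Suc k) - 1) (u - of_bool p) (w + of_bool q) p"
      by (rule main_reserve_step) (use 1 l3 k uw opp in auto)
    then show ?thesis using 1 by (simp add: simps)
  next
    case 2
    have "penultimate_reserve (int (Suc k)) u w (dropped c) \<le>
      of_bool (\<not> dropped c \<and> \<not> q \<and> u + w \<le> 1) +
      penultimate_reserve (int (Suc k) - 1) (u - of_bool p) (w + of_bool q) p"
      by (rule penultimate_reserve_step) (use 2 top uw opp in auto)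
    then show ?thesis using 2 by (simp add: simps)
  next
    case 3
    have "last_reserve (int (Suc k)) u w (dropped c) \<le>
      of_bool (\<not> dropped c \<and> \<not> q \<and> u + w \<le> 1) +
      last_reserve (int (Suc k) - 1) (u - of_bool p) (w + of_bool q) p"
      by (rule last_reserve_step) (use 3 top uw opp in auto)
    then show ?thesis using 3 by (simp add: simps)
  qed
qed

text \<open>
  Between blocks the state is only renamed, since the staircase descends by one row.
\<close>
lemma reserve_next_block:
  assumes h: "1 \<le> h" "Suc h < r" and c: "c \<le> m"
  shows "reserve h 0 c \<le> reserve (Suc h) (if Suc (Suc h) = r then 3 else l) c"
proof -
  define u w where "u = int h - int (\<rho> c)" and "w = int (\<beta> c) - int h"
  have eq: "int (Suc h) - int (\<rho> c) = u + 1" "int (\<beta> c) - int (Suc h) = w - 1"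
    by (simp_all add: u_def w_def)
  have uw: "0 \<le> u + w" using ordered[OF c] by (simp add: u_def w_def)
  have top: "w \<le> int r - int h" using \<beta>_le[of c] by (simp add: w_def)
  note unfold = reserve_def Let_def eq u_def[symmetric] w_def[symmetric]
  consider "h + 4 \<le> r" | "h + 3 = r" | "h + 2 = r" using h by linarith
  then show ?thesis
  proof cases
    case 1
    have "main_reserve (int l) (if h = 1 then int l - 3 else 0) 0 u w (dropped c) \<le>
      main_reserve (int l) 0 (int l) (u + 1) (w - 1) (dropped c)"
      by (rule main_reserve_next) (use l3 uw in auto)
    then show ?thesis unfolding unfold using 1 h by simp
  next
    case 2
    have "main_reserve (int l) 0 0 u w (dropped c) \<le>
          penultimate_reserve (int l) (u + 1) (w - 1) (dropped c)"
      by (rule main_reserve_penultimate) (use l3 uw top 2 in auto)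
    then show ?thesis unfolding unfold using 2 h r5 by simp
  next
    case 3
    have "penultimate_reserve 0 u w (dropped c) \<le> last_reserve 3 (u + 1) (w - 1) (dropped c)"
      by (rule penultimate_reserve_last) (use uw top 3 in auto)
    then show ?thesis unfolding unfold using 3 h r5 by simp
  qed
qed

lemma reserve_end: "reserve (r - 1) 0 m \<le> of_bool (near m)"
proof -
  define u where "u = int (r - 1) - int (\<rho> m)"
  have w: "int (\<beta> m) - int (r - 1) = 1" using \<beta>_end r5 by simp
  have "0 \<le> u + 1" using ordered[of m] \<beta>_end r5 by (simp add: u_def)
  then have "last_reserve 0 u 1 (dropped m) \<le> of_bool (\<not> dropped m \<and> u = -1)"
    by (rule last_reserve_end)
  moreover have "near m \<longleftrightarrow> \<not> dropped m \<and> u = -1"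
    using \<beta>_end r5 by (auto simp: near_def u_def)
  moreover have "reserve (r - 1) 0 m = last_reserve 0 u 1 (dropped m)"
    unfolding reserve_def Let_def w u_def[symmetric] using r5 by simp
  ultimately show ?thesis by simp
qed

lemma reserve_le_near_from:
  assumes "1 \<le> h" "h < r" "block_start r l h \<le> c" "c + k = block_start r l (Suc h)"
  shows "reserve h k c \<le> int (card (near_from c))"
  using assms
proof (induction "r - h" arbitrary: h k c)
  case 0
  then show ?case by simp
next
  case (Suc d)
  note IH = Suc.hyps(1) and d = Suc.hyps(2) and h = Suc.prems(1,2)
  show ?case using Suc.prems(3,4)
  proof (induction k arbitrary: c)
    case 0
    then have c: "c = block_start r l (Suc h)" by simp
    show ?case
    proof (cases "Suc h = r")
      case True
      then have "c = m" "h = r - 1" using c m by auto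
      moreover have "int (card (near_from m)) = of_bool (near m) + int (card (near_from (Suc m)))"
        by (rule card_near_from_step) simp
      ultimately show ?thesis using reserve_end by simp
    next
      case False
      let ?k = "if Suc (Suc h) = r then 3 else l"
      have next': "1 \<le> Suc h" "Suc h < r" using h False by auto
      have cm: "c \<le> m" unfolding c m using block_start_mono[OF r5] h by simp
      have "reserve h 0 c \<le> reserve (Suc h) ?k c"
        by (rule reserve_next_block) (use h next' cm in auto)
      also have "\<dots> \<le> int (card (near_from c))"
      proof (rule IH)
        show "c + ?k = block_start r l (Suc (Suc h))"
          unfolding block_start_Suc[OF r5 next'] c using h by auto
      qed (use d next' c in auto)
      finally show ?thesis .
    qed
  next
    case (Suc k)
    have c': "Suc c + k = block_start r l (Suc h)" using Suc.prems by simp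
    then have cm: "c \<le> m" using block_start_mono[OF r5, of "Suc h" r l] h m by simp
    have "reserve h (Suc k) c \<le> of_bool (near c) + reserve h k (Suc c)"
      using h Suc.prems(1) c' by (rule reserve_step)
    also have "reserve h k (Suc c) \<le> int (card (near_from (Suc c)))"
      using Suc.prems c' by (intro Suc.IH) auto
    finally show ?case using card_near_from_step[OF cm] by simp
  qed
qed

lemma many_near_columns: "l \<le> card {c. c \<le> m \<and> near c}"
proof -
  have \<beta>0: "1 \<le> \<beta> 0" using ordered[of 0] \<rho>_start by simp
  have "int l \<le> main_reserve (int l) (int l - 3) 3 0 (int (\<beta> 0) - 1) (int (\<beta> 0) - 1 \<noteq> 0)"
    by (rule main_reserve_start) (use l3 \<beta>0 in auto)
  also have "\<dots> = reserve 1 3 0"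
    using r5 \<beta>0 by (auto simp: reserve_def \<rho>_start dropped_def)
  also have "\<dots> \<le> int (card (near_from 0))"
    by (rule reserve_le_near_from) (use r5 in \<open>auto simp: block_start_def\<close>)
  finally show ?thesis by (simp add: near_from_def)
qed

end

section \<open>The staircase matroid\<close>

text \<open>
  Row \<open>i\<close> alternates up to the start of block \<open>i\<close> and is constant from there on. Hence at a gap
  of block \<open>h\<close> exactly the rows below \<open>h\<close> change, and a reorientation can only exchange the changing
  rows with the unchanging ones.
\<close>
definition staircase_matrix :: "nat \<Rightarrow> nat \<Rightarrow> nat \<Rightarrow> nat \<Rightarrow> real" where
  "staircase_matrix r l i e = (- 1) ^ min e (block_start r l i)"

lemma staircase_matrix_neg: "staircase_matrix r l i e < 0 \<longleftrightarrow> odd (min e (block_start r l i))"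
  by (cases "even (min e (block_start r l i))") (auto simp: staircase_matrix_def)

lemma many_interior_elements:
  fixes r l n :: nat
  assumes r: "5 \<le> r" and l: "3 \<le> l" and n: "block_start r l r < n"
  defines "\<C> \<equiv> uniform_dependencies.circuits (lawrence_dependencies n r (staircase_matrix r l)) r"
  assumes acyclic: "acyclic_om (reorientation A \<C>)"
  shows "l \<le> card (interior_elements {..<n} (reorientation A \<C>))"
proof -
  let ?s = "block_start r l"
  define m where "m = ?s r"
  interpret lawrence_matroid n r "staircase_matrix r l"
    by unfold_locales (use r in \<open>auto simp: staircase_matrix_def power_abs\<close>)
  note acyclic = acyclic[unfolded \<C>_def]
  let ?x = "entry A"
  let ?\<rho> = "top_row ?x" and ?\<beta> = "bottom_row ?x r m"
  have le: "?\<rho> c \<le> ?\<beta> c" if "c \<le> m" for c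
    using top_row_le_bottom_row[OF acyclic that] n by (simp add: m_def)
  have change: "?x i c \<noteq> ?x i (Suc c) \<longleftrightarrow> (c < ?s i) \<noteq> ((c \<in> A) \<noteq> (Suc c \<in> A))" for i c
    unfolding entry_def staircase_matrix_neg by (cases "c < ?s i") (auto simp: min_def)
  have top: "?\<rho> (Suc c) = (if ?x (?\<rho> c) c = ?x (?\<rho> c) (Suc c) then ?\<rho> c else Suc (?\<rho> c))" for c
    by (simp add: Let_def)
  have bottom: "?\<beta> (Suc c) = (if ?x (?\<beta> (Suc c)) c = ?x (?\<beta> (Suc c)) (Suc c) then ?\<beta> c else Suc (?\<beta> c))"
    if "c < m" for c
  proof -
    have "1 \<le> ?\<beta> (Suc c)" using le[of "Suc c"] top_row_pos[of ?x "Suc c"] that by linarith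
    then show ?thesis using bottom_row_step[OF that, of ?x r] by (simp add: Let_def)
  qed
  have if_Suc: "y \<noteq> z \<longleftrightarrow> \<not> P" if "y = (if P then z else Suc z)" for y z P
    using that by simp
  interpret corridor r l m ?\<rho> ?\<beta>
  proof
    show "5 \<le> r" "3 \<le> l" "m = ?s r" by (simp_all add: r l m_def)
    show "?\<rho> 0 = 1" "?\<beta> m = r" by simp_all
    show "?\<rho> (Suc c) = ?\<rho> c \<or> ?\<rho> (Suc c) = Suc (?\<rho> c)" for c using top[of c] by presburger
    show "?\<beta> (Suc c) = ?\<beta> c \<or> ?\<beta> (Suc c) = Suc (?\<beta> c)" if "c < m" for c
      using bottom[OF that] by presburger
    show "?\<beta> c \<le> r" for c by (rule bottom_row_le)
    show "?\<rho> c \<le> ?\<beta> c" if "c \<le> m" for c using that by (rule le)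
    show "(?\<rho> (Suc c) \<noteq> ?\<rho> c) \<noteq> (?\<beta> (Suc c) \<noteq> ?\<beta> c) \<longleftrightarrow> ?s (?\<rho> c) \<le> c \<and> c < ?s (?\<beta> (Suc c))"
      if c: "c < m" for c
    proof -
      have "?\<rho> (Suc c) \<noteq> ?\<rho> c \<longleftrightarrow> ?x (?\<rho> c) c \<noteq> ?x (?\<rho> c) (Suc c)"
        by (rule if_Suc[OF top])
      moreover have "?\<beta> (Suc c) \<noteq> ?\<beta> c \<longleftrightarrow> ?x (?\<beta> (Suc c)) c \<noteq> ?x (?\<beta> (Suc c)) (Suc c)"
        by (rule if_Suc[OF bottom[OF c]])
      moreover have "?s (?\<rho> c) \<le> ?s (?\<beta> (Suc c))"
      proof (rule block_start_mono[OF r])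
        have "?\<rho> c \<le> ?\<rho> (Suc c)" by (simp add: Let_def)
        then show "?\<rho> c \<le> ?\<beta> (Suc c)" using le[of "Suc c"] c by simp
      qed (rule bottom_row_le)
      ultimately show ?thesis unfolding change by (meson leD leI less_le_trans)
    qed
  qed
  have "c \<in> interior_elements {..<n} (reorientation A circuits)" if "c \<le> m" "near c" for c
  proof (rule interior_element_near_travels[OF acyclic])
    show "c \<le> m" "?\<beta> c \<le> Suc (?\<rho> c)" using that by (simp_all add: near_def)
    show "m < n" using n by (simp add: m_def)
    show "0 < m" using r by (simp add: m_def block_start_def)
    show "case c of 0 \<Rightarrow> ?\<beta> 0 = 1 | Suc c' \<Rightarrow> ?\<rho> c' = ?\<rho> c"
      using that(2) by (cases c) (simp_all add: near_def dropped_def del: top_row.simps(2))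
    show "if c = m then ?\<rho> c = r else ?\<beta> c = ?\<beta> (Suc c)"
      using that(2) unfolding near_def by blast
  qed
  then have "{c. c \<le> m \<and> near c} \<subseteq> interior_elements {..<n} (reorientation A circuits)" by blast
  then have "card {c. c \<le> m \<and> near c} \<le> card (interior_elements {..<n} (reorientation A circuits))"
    by (rule card_mono[rotated]) (simp add: interior_elements_def)
  then show ?thesis using many_near_columns unfolding \<C>_def by linarith
qed

lemma reorientable_sizes_bound:
  assumes d: "4 \<le> d" and t: "2 \<le> t" and n: "n \<in> reorientable_sizes t d"
  shows "n \<le> block_start (d + 1) (t + 1) (d + 1)"
proof (rule ccontr)
  let ?r = "d + 1" and ?l = "t + 1"
  assume "\<not> ?thesis"
  then have big: "block_start ?r ?l ?r < n" by simp
  interpret lawrence_matroid n ?r "staircase_matrix ?r ?l"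
    by unfold_locales (auto simp: staircase_matrix_def power_abs)
  have "?r \<le> block_start ?r ?l ?r"
  proof -
    obtain k where "d = k + 4" using d by (metis add.commute le_Suc_ex)
    then show ?thesis by (simp add: block_start_def)
  qed
  then have "?r \<le> card {..<n}" using big by simp
  then have "uniform_om {..<n} circuits" "om_rank {..<n} circuits = d + 1"
    by (rule uniform_om_circuits, rule om_rank_circuits)
  then obtain A where "acyclic_om (reorientation A circuits)"
    "card (interior_elements {..<n} (reorientation A circuits)) \<le> t"
    using n oriented_matroid_circuits unfolding reorientable_sizes_def by fastforce
  then show False using many_interior_elements[of ?r ?l n A] d t big by simp
qed

theorem theorem6:
  fixes t d :: nat
  assumes "d \<ge> 4" and "t \<ge> 2"
  shows "finite (reorientable_sizes t d) \<and>
         int (nbar t d) < 2 * int d + (int t - 1) * (int d - 2) + 3"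
proof
  have bound: "reorientable_sizes t d \<subseteq> {..block_start (d + 1) (t + 1) (d + 1)}"
    using reorientable_sizes_bound[OF assms] by auto
  then show fin: "finite (reorientable_sizes t d)" by (rule finite_subset) simp
  have "nbar t d \<in> reorientable_sizes t d"
    unfolding nbar_def using fin zero_in_reorientable_sizes by (intro Max_in) auto
  then have "nbar t d \<le> block_start (d + 1) (t + 1) (d + 1)" using bound by auto
  moreover have "int (block_start (d + 1) (t + 1) (d + 1)) + 1 =
      2 * int d + (int t - 1) * (int d - 2) + 3"
  proof -
    obtain k where "d = k + 4" using assms(1) by (metis add.commute le_Suc_ex)
    then show ?thesis by (simp add: block_start_def algebra_simps)
  qed
  ultimately show "int (nbar t d) < 2 * int d + (int t - 1) * (int d - 2) + 3" by linarith
qed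

end
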